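(* Let $\alpha > -\frac14$, let $V \in L^2_{\mathrm{loc}}(\mathbb{R}^+)$ be real-valued, and let $A$ be the linear operator on $L^2(\mathbb{R}^+)$ with domain $\mathcal{D}(A) = C_c^\infty(\mathbb{R}^+)$ given by $$Au(\rho) := -u''(\rho) + \frac{\alpha}{\rho^2}u(\rho) + V(\rho)u(\rho).$$ Assume that $V$ is such that the closure $\mathcal{A}$ of $A$ is self-adjoint. Write $V = V_+ - V_-$, where $V_\pm \geq 0$ are the positive and negative parts of $V$, and let $p \geq 1$. If $$\int_{\mathbb{R}^+} \rho^{2p-1}|V_-(\rho)|^p\, d\rho < \frac{(4\alpha+1)^{\frac{2p-1}{2}}\, p^p\, \Gamma(p)^2}{(p-1)^{p-1}\,\Gamma(2p)},$$ then $\sigma(\mathcal{A}) \subseteq [0,+\infty)$. Furthermore, zero is not an eigenvalue of $\mathcal{A}$.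
   Context: $\mathbb{R}^+ = (0,\infty)$. $\Gamma$ is the Gamma function, $\sigma(\mathcal A)$ denotes the spectrum of $\mathcal A$, and for $p = 1$ the expression $(p-1)^{p-1}$ is understood as $1$. *)

theory Defs
  imports "HOL-Analysis.Analysis"
begin

section \<open>The complex Hilbert space of square-integrable functions on the half-line\<close>

abbreviation halfline :: "real measure" where
  "halfline \<equiv> lebesgue_on {0<..}"

definition square_integrable :: "(real \<Rightarrow> complex) \<Rightarrow> bool" where
  "square_integrable f \<longleftrightarrow>
     f \<in> borel_measurable halfline \<and> integrable halfline (\<lambda>x. (cmod (f x))\<^sup>2)"

definition L2_eq :: "(real \<Rightarrow> complex) \<Rightarrow> (real \<Rightarrow> complex) \<Rightarrow> bool" where
  "L2_eq f g \<longleftrightarrow>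
     square_integrable f \<and> square_integrable g \<and> (AE x in halfline. f x = g x)"

lemma square_integrable_zero: "square_integrable (\<lambda>x. 0)"
  by (simp add: square_integrable_def)

lemma square_integrable_mult_cnj:
  assumes "square_integrable f" "square_integrable g"
  shows "integrable halfline (\<lambda>x. f x * cnj (g x))"
proof (rule Bochner_Integration.integrable_bound)
  show "integrable halfline (\<lambda>x. (cmod (f x))\<^sup>2 + (cmod (g x))\<^sup>2)"
    using assms by (auto simp: square_integrable_def)
  have [measurable]: "f \<in> borel_measurable halfline" "g \<in> borel_measurable halfline"
    using assms by (auto simp: square_integrable_def)
  have "(\<lambda>x. cnj (g x)) \<in> borel_measurable halfline"
    by (rule borel_measurable_continuous_on) (auto intro: continuous_intros)
  then show "(\<lambda>x. f x * cnj (g x)) \<in> borel_measurable halfline" by measurable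
  show "AE x in halfline. norm (f x * cnj (g x)) \<le> norm ((cmod (f x))\<^sup>2 + (cmod (g x))\<^sup>2)"
  proof (rule AE_I2)
    fix x
    have "0 \<le> (cmod (f x) - cmod (g x))\<^sup>2" "0 \<le> cmod (f x) * cmod (g x)" by simp_all
    then show "norm (f x * cnj (g x)) \<le> norm ((cmod (f x))\<^sup>2 + (cmod (g x))\<^sup>2)"
      unfolding norm_mult power2_diff real_norm_def complex_mod_cnj by linarith
  qed
qed

lemma square_integrable_add:
  assumes "square_integrable f" "square_integrable g"
  shows "square_integrable (\<lambda>x. f x + g x)"
proof -
  have [measurable]: "f \<in> borel_measurable halfline" "g \<in> borel_measurable halfline"
    using assms by (auto simp: square_integrable_def)
  have "integrable halfline (\<lambda>x. (cmod (f x + g x))\<^sup>2)"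
  proof (rule Bochner_Integration.integrable_bound)
    show "integrable halfline (\<lambda>x. 2 * (cmod (f x))\<^sup>2 + 2 * (cmod (g x))\<^sup>2)"
      using assms by (auto simp: square_integrable_def)
    show "AE x in halfline. norm ((cmod (f x + g x))\<^sup>2)
            \<le> norm (2 * (cmod (f x))\<^sup>2 + 2 * (cmod (g x))\<^sup>2)"
    proof (rule AE_I2)
      fix x
      have "(cmod (f x + g x))\<^sup>2 \<le> (cmod (f x) + cmod (g x))\<^sup>2"
        by (intro power_mono norm_triangle_ineq) auto
      moreover have "0 \<le> (cmod (f x) - cmod (g x))\<^sup>2" by simp
      ultimately show "norm ((cmod (f x + g x))\<^sup>2)
            \<le> norm (2 * (cmod (f x))\<^sup>2 + 2 * (cmod (g x))\<^sup>2)"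
        by (simp add: power2_sum power2_diff)
    qed
  qed measurable
  then show ?thesis by (simp add: square_integrable_def)
qed

lemma square_integrable_scale:
  assumes "square_integrable f"
  shows "square_integrable (\<lambda>x. c * f x)"
  using assms by (auto simp: square_integrable_def norm_mult power_mult_distrib)

lemma square_integrable_uminus:
  assumes "square_integrable f"
  shows "square_integrable (\<lambda>x. - f x)"
  using square_integrable_scale[OF assms, of "-1"] by simp

lemma square_integrable_diff:
  assumes "square_integrable f" "square_integrable g"
  shows "square_integrable (\<lambda>x. f x - g x)"
  using square_integrable_add[OF assms(1) square_integrable_uminus[OF assms(2)]] by simp

quotient_type L2 = "real \<Rightarrow> complex" / partial: L2_eq
proof (rule part_equivpI)
  show "\<exists>f. L2_eq f f"
    using square_integrable_zero by (auto simp: L2_eq_def)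
  show "symp L2_eq"
    by (auto simp: symp_def L2_eq_def)
  show "transp L2_eq"
    by (auto simp: transp_def L2_eq_def)
qed

text \<open>Linear in the first argument.\<close>

lift_definition cinner :: "L2 \<Rightarrow> L2 \<Rightarrow> complex"
  is "\<lambda>f g. \<integral>x. f x * cnj (g x) \<partial>halfline"
  by (rule integral_cong_AE)
    (auto simp: L2_eq_def dest: square_integrable_mult_cnj)

lift_definition scaleC :: "complex \<Rightarrow> L2 \<Rightarrow> L2" (infixr \<open>*\<^sub>C\<close> 75)
  is "\<lambda>c f x. c * f x"
  by (auto simp: L2_eq_def intro: square_integrable_scale)

instantiation L2 :: real_inner
begin

lift_definition zero_L2 :: L2 is "\<lambda>x. 0"
  by (simp add: L2_eq_def square_integrable_zero)

lift_definition plus_L2 :: "L2 \<Rightarrow> L2 \<Rightarrow> L2" is "\<lambda>f g x. f x + g x"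
  by (auto simp: L2_eq_def intro: square_integrable_add)

lift_definition minus_L2 :: "L2 \<Rightarrow> L2 \<Rightarrow> L2" is "\<lambda>f g x. f x - g x"
  by (auto simp: L2_eq_def intro: square_integrable_diff)

lift_definition uminus_L2 :: "L2 \<Rightarrow> L2" is "\<lambda>f x. - f x"
  by (auto simp: L2_eq_def intro: square_integrable_uminus)

definition scaleR_L2 :: "real \<Rightarrow> L2 \<Rightarrow> L2" where
  "scaleR_L2 r f = complex_of_real r *\<^sub>C f"

definition inner_L2 :: "L2 \<Rightarrow> L2 \<Rightarrow> real" where
  "inner_L2 f g = Re (cinner f g)"

definition norm_L2 :: "L2 \<Rightarrow> real" where
  "norm_L2 f = sqrt (inner f f)"

definition sgn_L2 :: "L2 \<Rightarrow> L2" where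
  "sgn_L2 f = scaleR (inverse (norm f)) f"

definition dist_L2 :: "L2 \<Rightarrow> L2 \<Rightarrow> real" where
  "dist_L2 f g = norm (f - g)"

definition uniformity_L2 :: "(L2 \<times> L2) filter" where
  "uniformity_L2 = (INF e\<in>{0<..}. principal {(f, g). dist f g < e})"

definition open_L2 :: "L2 set \<Rightarrow> bool" where
  "open_L2 U \<longleftrightarrow> (\<forall>f\<in>U. \<forall>\<^sub>F (f', g) in uniformity. f' = f \<longrightarrow> g \<in> U)"

instance
proof
  fix f g h :: L2 and r s :: real
  show "f + g + h = f + (g + h)" by transfer (simp add: L2_eq_def add.assoc square_integrable_add)
  show "f + g = g + f" by transfer (simp add: L2_eq_def add.commute square_integrable_add)
  show "0 + f = f" by transfer simp
  show "- f + f = 0" by transfer (simp add: L2_eq_def square_integrable_zero)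
  show "f - g = f + - g"
    by transfer (simp add: L2_eq_def square_integrable_add square_integrable_uminus
        square_integrable_diff)
  show "r *\<^sub>R (f + g) = r *\<^sub>R f + r *\<^sub>R g"
    unfolding scaleR_L2_def
    by transfer (simp add: L2_eq_def distrib_left distrib_right mult.assoc square_integrable_add square_integrable_scale)
  show "(r + s) *\<^sub>R f = r *\<^sub>R f + s *\<^sub>R f"
    unfolding scaleR_L2_def
    by transfer (simp add: L2_eq_def distrib_left distrib_right mult.assoc square_integrable_add square_integrable_scale)
  show "r *\<^sub>R s *\<^sub>R f = (r * s) *\<^sub>R f"
    unfolding scaleR_L2_def
    by transfer (simp add: L2_eq_def distrib_left distrib_right mult.assoc square_integrable_scale)
  show "1 *\<^sub>R f = f"
    unfolding scaleR_L2_def by transfer simp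
  show "sgn f = inverse (norm f) *\<^sub>R f" by (rule sgn_L2_def)
  show "dist f g = norm (f - g)" by (rule dist_L2_def)
  show "(uniformity :: (L2 \<times> L2) filter) = (INF e\<in>{0<..}. principal {(f, g). dist f g < e})"
    by (rule uniformity_L2_def)
  show "open U \<longleftrightarrow> (\<forall>f\<in>U. \<forall>\<^sub>F (f', g) in uniformity. f' = f \<longrightarrow> g \<in> U)" for U :: "L2 set"
    by (rule open_L2_def)
  show "norm f = sqrt (f \<bullet> f)" by (rule norm_L2_def)
  have comm: "cinner f g = cnj (cinner g f)"
    by transfer (simp add: L2_eq_def flip: Bochner_Integration.integral_cnj add: mult.commute)
  show "f \<bullet> g = g \<bullet> f"
    unfolding inner_L2_def by (subst comm) simp
  have "cinner (f + g) h = cinner f h + cinner g h"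
    by transfer (simp add: L2_eq_def distrib_right square_integrable_mult_cnj)
  then show "(f + g) \<bullet> h = f \<bullet> h + g \<bullet> h"
    by (simp add: inner_L2_def)
  have "cinner (complex_of_real r *\<^sub>C f) g = complex_of_real r * cinner f g"
    by transfer (simp add: mult.assoc)
  then show "(r *\<^sub>R f) \<bullet> g = r * (f \<bullet> g)"
    by (simp add: inner_L2_def scaleR_L2_def)
  have self: "cinner f f = complex_of_real (\<integral>x. (cmod (rep_L2 f x))\<^sup>2 \<partial>halfline)"
    by (simp only: cinner.rep_eq flip: complex_norm_square integral_complex_of_real)
  show "0 \<le> f \<bullet> f" by (simp add: inner_L2_def self)
  have rep: "square_integrable (rep_L2 f)"
    using Quotient3_rep_reflp[OF Quotient3_L2, of f] by (simp add: L2_eq_def)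
  have "f \<bullet> f = 0 \<longleftrightarrow> (AE x in halfline. (cmod (rep_L2 f x))\<^sup>2 = 0)"
    using rep unfolding inner_L2_def self Re_complex_of_real
    by (intro integral_nonneg_eq_0_iff_AE) (auto simp: square_integrable_def)
  also have "\<dots> \<longleftrightarrow> L2_eq (rep_L2 f) (\<lambda>x. 0)"
    using rep by (simp add: L2_eq_def square_integrable_zero)
  also have "\<dots> \<longleftrightarrow> f = 0"
    using rep Quotient3_rel[OF Quotient3_L2, of "rep_L2 f" "\<lambda>x. 0"]
    by (simp add: Quotient3_abs_rep[OF Quotient3_L2] L2_eq_def square_integrable_zero
        flip: zero_L2.abs_eq)
  finally show "f \<bullet> f = 0 \<longleftrightarrow> f = 0" .
qed

end

section \<open>Unbounded operators\<close>

text \<open>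
  An unbounded operator is identified with its graph, so that its closure is the topological
  \<^const>\<open>closure\<close> of the graph in the product space.
\<close>

type_synonym L2_graph = "(L2 \<times> L2) set"

definition linear_operator :: "L2_graph \<Rightarrow> bool" where
  "linear_operator T \<longleftrightarrow>
     (0, 0) \<in> T \<and>
     (\<forall>u w u' w'. (u, w) \<in> T \<longrightarrow> (u', w') \<in> T \<longrightarrow> (u + u', w + w') \<in> T) \<and>
     (\<forall>c u w. (u, w) \<in> T \<longrightarrow> (c *\<^sub>C u, c *\<^sub>C w) \<in> T) \<and>
     single_valued T"

definition adjoint_graph :: "L2_graph \<Rightarrow> L2_graph" where
  "adjoint_graph T = {(v, z). \<forall>(u, w)\<in>T. cinner w v = cinner u z}"

definition self_adjoint :: "L2_graph \<Rightarrow> bool" where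
  "self_adjoint T \<longleftrightarrow>
     linear_operator T \<and> closure (Domain T) = UNIV \<and> adjoint_graph T = T"

definition resolvent_set :: "L2_graph \<Rightarrow> complex set" where
  "resolvent_set T =
     {z. \<exists>R. bounded_linear R \<and> {(w - z *\<^sub>C u, u) |u w. (u, w) \<in> T} = {(f, R f) |f. True}}"

definition spectrum :: "L2_graph \<Rightarrow> complex set" where
  "spectrum T = - resolvent_set T"

definition eigenvalue :: "L2_graph \<Rightarrow> complex \<Rightarrow> bool" where
  "eigenvalue T z \<longleftrightarrow> (\<exists>u. u \<noteq> 0 \<and> (u, z *\<^sub>C u) \<in> T)"

section \<open>The Schroedinger operator on test functions\<close>

abbreviation vderiv :: "(real \<Rightarrow> complex) \<Rightarrow> real \<Rightarrow> complex" where
  "vderiv u \<equiv> \<lambda>x. vector_derivative u (at x)"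

definition smooth :: "(real \<Rightarrow> complex) \<Rightarrow> bool" where
  "smooth u \<longleftrightarrow> (\<forall>n x. (vderiv ^^ n) u differentiable at x)"

text \<open>A test function on the half-line is extended by zero to the whole line.\<close>

definition test_functions :: "(real \<Rightarrow> complex) set" where
  "test_functions = {u. smooth u \<and> (\<exists>K. compact K \<and> K \<subseteq> {0<..} \<and> (\<forall>x. x \<notin> K \<longrightarrow> u x = 0))}"

definition L2_loc :: "(real \<Rightarrow> real) set" where
  "L2_loc = {V. V \<in> borel_measurable halfline \<and>
     (\<forall>K. compact K \<longrightarrow> K \<subseteq> {0<..} \<longrightarrow> set_integrable lebesgue K (\<lambda>x. (V x)\<^sup>2))}"

definition schroedinger_expr ::
  "real \<Rightarrow> (real \<Rightarrow> real) \<Rightarrow> (real \<Rightarrow> complex) \<Rightarrow> real \<Rightarrow> complex" where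
  "schroedinger_expr \<alpha> V u \<rho> =
     - vderiv (vderiv u) \<rho> + complex_of_real (\<alpha> / \<rho>\<^sup>2) * u \<rho> + complex_of_real (V \<rho>) * u \<rho>"

definition schroedinger_min :: "real \<Rightarrow> (real \<Rightarrow> real) \<Rightarrow> L2_graph" where
  "schroedinger_min \<alpha> V =
     {(abs_L2 u, abs_L2 (schroedinger_expr \<alpha> V u)) |u. u \<in> test_functions}"

text \<open>
  The quotient map \<^const>\<open>abs_L2\<close> is only meaningful on square-integrable functions; both
  occurrences of it in \<^const>\<open>schroedinger_min\<close> are of this kind if \<open>V \<in> L2_loc\<close>.
\<close>

lemma square_integrable_continuous_compact_support:
  assumes "compact K" "K \<subseteq> {0<..}" "continuous_on K f" "\<And>x. x \<notin> K \<Longrightarrow> f x = 0"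
  shows "square_integrable f"
proof -
  have K [measurable]: "K \<in> sets lebesgue" and K': "K \<in> sets halfline"
    using assms(1,2) by (auto simp: sets_restrict_space_iff lmeasurable_compact fmeasurableD)
  have f_eq: "f = (\<lambda>x. indicator K x *\<^sub>R f x)"
    using assms(4) by (auto simp: fun_eq_iff indicator_def)
  have "f \<in> borel_measurable (lebesgue_on K)"
    using assms(3) K by (rule continuous_imp_measurable_on_sets_lebesgue)
  then have meas: "f \<in> borel_measurable lebesgue"
    using K f_eq by (simp add: borel_measurable_restrict_space_iff)
  have "continuous_on K (\<lambda>x. (cmod (f x))\<^sup>2)"
    using assms(3) by (intro continuous_intros)
  then have "set_integrable lborel K (\<lambda>x. (cmod (f x))\<^sup>2)"
    unfolding set_integrable_def
    using assms(1) borel_integrable_compact by blast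
  moreover have "indicator K x *\<^sub>R (cmod (f x))\<^sup>2 = (cmod (f x))\<^sup>2" for x
    using assms(4) by (auto simp: indicator_def)
  ultimately have "integrable lborel (\<lambda>x. (cmod (f x))\<^sup>2)"
    by (simp only: set_integrable_def)
  then have "integrable lebesgue (\<lambda>x. (cmod (f x))\<^sup>2)"
    by (simp add: integrable_completion)
  then have "integrable lebesgue (\<lambda>x. indicator {0<..} x *\<^sub>R (cmod (f x))\<^sup>2)"
    by (intro integrable_mult_indicator) simp_all
  then have "integrable halfline (\<lambda>x. (cmod (f x))\<^sup>2)"
    by (simp add: integrable_restrict_space)
  with meas show ?thesis
    by (simp add: square_integrable_def measurable_restrict_space1)
qed

lemma test_functions_continuous:
  assumes "u \<in> test_functions"
  shows "continuous_on S ((vderiv ^^ n) u)"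
proof (rule continuous_at_imp_continuous_on, intro ballI)
  fix x
  have "(vderiv ^^ n) u differentiable at x"
    using assms by (simp add: test_functions_def smooth_def)
  then show "isCont ((vderiv ^^ n) u) x"
    by (rule differentiable_imp_continuous_within)
qed

lemma test_functions_square_integrable:
  assumes "u \<in> test_functions"
  shows "square_integrable u"
  using assms test_functions_continuous[OF assms, of _ 0]
    square_integrable_continuous_compact_support
  by (auto simp: test_functions_def)

lemma schroedinger_expr_square_integrable:
  assumes u: "u \<in> test_functions" and V: "V \<in> L2_loc"
  shows "square_integrable (schroedinger_expr \<alpha> V u)"
proof -
  obtain K where K: "compact K" "K \<subseteq> {0<..}" and supp: "\<And>x. x \<notin> K \<Longrightarrow> u x = 0"
    using u by (auto simp: test_functions_def)
  note cont = test_functions_continuous[OF u]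
  have contu: "continuous_on K u" using cont[of K 0] by simp
  have supp_vderiv: "vderiv g x = 0" if "\<And>x. x \<notin> K \<Longrightarrow> g x = 0" "x \<notin> K" for g x
  proof (rule vector_derivative_at)
    have "open (- K)" "x \<in> - K" using K that by (auto intro: compact_imp_closed)
    then show "(g has_vector_derivative 0) (at x)"
      using that(1)
      by (intro has_vector_derivative_transform_within_open[of "\<lambda>_. 0" 0 x "- K" g]) auto
  qed
  have 1: "square_integrable (vderiv (vderiv u))"
  proof (rule square_integrable_continuous_compact_support[OF K])
    show "continuous_on K (vderiv (vderiv u))"
      using cont[of K 2] by (simp add: numeral_2_eq_2)
    show "vderiv (vderiv u) x = 0" if "x \<notin> K" for x
      using that by (intro supp_vderiv) (auto intro!: supp_vderiv supp)
  qed
  have 2: "square_integrable (\<lambda>x. complex_of_real (\<alpha> / x\<^sup>2) * u x)"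
  proof (rule square_integrable_continuous_compact_support[OF K])
    show "continuous_on K (\<lambda>x. complex_of_real (\<alpha> / x\<^sup>2) * u x)"
      using K(2) by (intro continuous_intros contu) auto
  qed (simp add: supp)
  have 3: "square_integrable (\<lambda>x. complex_of_real (V x) * u x)"
    unfolding square_integrable_def
  proof
    have [measurable]: "V \<in> borel_measurable halfline" "u \<in> borel_measurable halfline"
      using V test_functions_square_integrable[OF u]
      by (auto simp: L2_loc_def square_integrable_def)
    show meas: "(\<lambda>x. complex_of_real (V x) * u x) \<in> borel_measurable halfline"
      by measurable
    obtain M where M: "\<And>x. x \<in> K \<Longrightarrow> cmod (u x) \<le> M"
      using compact_imp_bounded[OF compact_continuous_image[OF contu K(1)]]
      by (auto simp: bounded_iff)
    have Kset: "{0<..} \<inter> K = K" using K(2) by auto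
    show "integrable halfline (\<lambda>x. (cmod (complex_of_real (V x) * u x))\<^sup>2)"
    proof (rule Bochner_Integration.integrable_bound)
      have "integrable lebesgue (\<lambda>x. indicator K x *\<^sub>R (V x)\<^sup>2)"
        using V K by (auto simp: L2_loc_def set_integrable_def)
      moreover have "indicator {0<..} x *\<^sub>R (M\<^sup>2 * (indicator K x *\<^sub>R (V x)\<^sup>2))
          = M\<^sup>2 * (indicator K x *\<^sub>R (V x)\<^sup>2)" for x
        using K(2) by (auto simp: indicator_def)
      ultimately show "integrable halfline (\<lambda>x. M\<^sup>2 * (indicator K x *\<^sub>R (V x)\<^sup>2))"
        by (subst integrable_restrict_space) (simp_all only: integrable_mult_right, simp)
      show "AE x in halfline. norm ((cmod (complex_of_real (V x) * u x))\<^sup>2)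
          \<le> norm (M\<^sup>2 * (indicator K x *\<^sub>R (V x)\<^sup>2))"
      proof (rule AE_I2)
        fix x
        show "norm ((cmod (complex_of_real (V x) * u x))\<^sup>2)
          \<le> norm (M\<^sup>2 * (indicator K x *\<^sub>R (V x)\<^sup>2))"
          using supp[of x] M[of x]
          by (cases "x \<in> K")
            (auto simp: norm_mult power_mult_distrib mult.commute[of "M\<^sup>2"]
              intro!: mult_left_mono power_mono)
      qed
    qed (use meas in measurable)
  qed
  have "square_integrable (\<lambda>x. - vderiv (vderiv u) x + complex_of_real (\<alpha> / x\<^sup>2) * u x
      + complex_of_real (V x) * u x)"
    by (intro square_integrable_add square_integrable_uminus 1 2 3)
  then show ?thesis
    by (simp add: schroedinger_expr_def[abs_def])
qed

end

theory Submission
  imports Defs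
begin

text \<open>
  Write \<open>k = \<alpha> + 1/4\<close>, \<open>\<kappa> = sqrt k\<close> and \<open>f(\<rho>) = sqrt \<rho> * w(\<rho>)\<close> for a real test function \<open>f\<close>. Up to a total
  derivative, the energy density of \<open>f\<close> is \<open>\<rho> w'^2 + \<kappa>^2 w^2 / \<rho> + \<rho> V w^2\<close>. Let \<open>M\<close> be the maximum
  of \<open>\<bar>w\<bar>\<close>, attained at \<open>c\<close>, and let \<open>t = w / M\<close>, so that \<open>\<bar>t\<bar> \<le> 1\<close>. The argument is a
  calibration with the function \<open>g(t) = \<bar>t\<bar> sqrt (1 - \<bar>t\<bar> powr (2/(p-1)))\<close> (with \<open>g(t) = \<bar>t\<bar>\<close> for
  \<open>p = 1\<close>), whose odd primitive is called \<open>G\<close>: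

  \<^item> Young's inequality, for the negative part of the potential, reads
    \<open>X t^2 \<le> k (t^2 - g(t)^2) + C X powr p\<close> for \<open>X = \<rho>^2 V_-\<close>, with \<open>C\<close> explicit (\<open>young_profile\<close>).

  \<^item> Completing the square, \<open>\<rho> w'^2 + \<kappa>^2 M^2 g(t)^2 / \<rho> \<ge> \<plusminus> 2 \<kappa> M^2 (G(t))'\<close>.

  With opposite signs on the two sides of \<open>c\<close>, the total derivatives contribute
  \<open>4 \<kappa> M^2 G(1)\<close>, and the energy is at least \<open>M^2 \<delta>\<close> with \<open>\<delta> = 4 \<kappa> G(1) - C I\<close>, where \<open>I\<close> is the
  integral of \<open>\<rho> powr (2p-1) * V_- powr p\<close> (\<open>real_form_lower_bound\<close>). The number \<open>G(1)\<close> is a Beta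
  integral, and by Legendre's duplication formula \<open>\<delta> > 0\<close> is exactly the hypothesis on \<open>V_-\<close>
  (\<open>coupling_threshold_eq\<close>). Since \<open>V\<close> is real, real and imaginary parts can be added, so that
  \<open>\<delta> \<bar>u(\<rho>)\<bar>^2 \<le> \<rho> \<langle>A u, u\<rangle>\<close> for every test function \<open>u\<close> and every \<open>\<rho> > 0\<close>
  (\<open>schroedinger_form_lower_bound\<close>).

  Both claims follow. The form of the closure is nonnegative, and a nonnegative self-adjoint
  operator has its spectrum in \<open>[0, \<infinity>)\<close> (\<open>self_adjoint_nonneg_spectrum\<close>); this uses the completeness
  of the Hilbert space. If \<open>u\<close> is in the kernel, it is the limit of test functions \<open>\<phi>\<^sub>n\<close> with
  \<open>A \<phi>\<^sub>n \<longlonglongrightarrow> 0\<close>; then \<open>\<langle>A \<phi>\<^sub>n, \<phi>\<^sub>n\<rangle> \<longlonglongrightarrow> 0\<close>, so \<open>\<phi>\<^sub>n \<longlonglongrightarrow> 0\<close> pointwise and \<open>u = 0\<close> by Fatou's lemma.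
\<close>

section \<open>Completeness of the Hilbert space\<close>

lemma L2_cases:
  obtains f where "square_integrable f" "u = abs_L2 f"
proof
  show "square_integrable (rep_L2 u)"
    using Quotient3_rep_reflp[OF Quotient3_L2, of u] by (simp add: L2_eq_def)
  show "u = abs_L2 (rep_L2 u)"
    by (simp add: Quotient3_abs_rep[OF Quotient3_L2])
qed

lemma L2_eq_refl: "square_integrable f \<Longrightarrow> L2_eq f f"
  by (simp add: L2_eq_def)

lemma abs_L2_diff:
  assumes "square_integrable f" "square_integrable g"
  shows "abs_L2 f - abs_L2 g = abs_L2 (\<lambda>x. f x - g x)"
  using assms by (simp add: minus_L2.abs_eq L2_eq_refl)

lemma cinner_abs_L2:
  assumes "square_integrable f" "square_integrable g"
  shows "cinner (abs_L2 f) (abs_L2 g) = (\<integral>x. f x * cnj (g x) \<partial>halfline)"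
  using assms by (simp add: cinner.abs_eq L2_eq_refl)

lemma norm_abs_L2:
  assumes "square_integrable f"
  shows "(norm (abs_L2 f))\<^sup>2 = (\<integral>x. (cmod (f x))\<^sup>2 \<partial>halfline)"
proof -
  have "cinner (abs_L2 f) (abs_L2 f) = complex_of_real (\<integral>x. (cmod (f x))\<^sup>2 \<partial>halfline)"
    by (simp only: cinner_abs_L2[OF assms assms] flip: complex_norm_square integral_complex_of_real)
  then show ?thesis
    by (simp add: power2_norm_eq_inner inner_L2_def)
qed

lemma nn_integral_norm_abs_L2:
  assumes "square_integrable f"
  shows "(\<integral>\<^sup>+ x. ennreal ((cmod (f x))\<^sup>2) \<partial>halfline) = ennreal ((norm (abs_L2 f))\<^sup>2)"
  using assms unfolding norm_abs_L2[OF assms]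
  by (intro nn_integral_eq_integral) (auto simp: square_integrable_def)

lemma square_integrable_iff_nn_integral:
  "square_integrable f \<longleftrightarrow> f \<in> borel_measurable halfline \<and>
     (\<integral>\<^sup>+ x. ennreal ((cmod (f x))\<^sup>2) \<partial>halfline) < \<infinity>"
  by (auto simp: square_integrable_def integrable_iff_bounded)

text \<open>
  Fatou's lemma for the \<open>L2\<close> norm: closed balls are stable under pointwise limits. In
  particular the limit of a pointwise convergent bounded sequence is square-integrable.
\<close>

lemma L2_limit_pointwise_AE:
  fixes F :: "nat \<Rightarrow> real \<Rightarrow> complex"
  assumes F: "\<And>k. square_integrable (F k)" and g: "square_integrable g"
    and f: "f \<in> borel_measurable halfline"
    and lim: "AE x in halfline. (\<lambda>k. F k x) \<longlonglongrightarrow> f x"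
    and le: "\<forall>\<^sub>F k in sequentially. norm (abs_L2 (F k) - abs_L2 g) \<le> e"
  shows "square_integrable f \<and> norm (abs_L2 f - abs_L2 g) \<le> e"
proof -
  have [measurable]: "f \<in> borel_measurable halfline" "g \<in> borel_measurable halfline"
      "\<And>k. F k \<in> borel_measurable halfline"
    using assms by (auto simp: square_integrable_def)
  have e: "0 \<le> e"
    using eventually_happens[OF le] by (auto intro: order_trans[OF norm_ge_zero])
  have "(\<integral>\<^sup>+ x. ennreal ((cmod (f x - g x))\<^sup>2) \<partial>halfline)
      = (\<integral>\<^sup>+ x. liminf (\<lambda>k. ennreal ((cmod (F k x - g x))\<^sup>2)) \<partial>halfline)"
  proof (rule nn_integral_cong_AE)
    show "AE x in halfline. ennreal ((cmod (f x - g x))\<^sup>2)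
        = liminf (\<lambda>k. ennreal ((cmod (F k x - g x))\<^sup>2))"
      using lim
    proof eventually_elim
      fix x assume "(\<lambda>k. F k x) \<longlonglongrightarrow> f x"
      then have "(\<lambda>k. ennreal ((cmod (F k x - g x))\<^sup>2)) \<longlonglongrightarrow> ennreal ((cmod (f x - g x))\<^sup>2)"
        by (intro tendsto_ennrealI tendsto_intros)
      then show "ennreal ((cmod (f x - g x))\<^sup>2) = liminf (\<lambda>k. ennreal ((cmod (F k x - g x))\<^sup>2))"
        by (rule lim_imp_Liminf[OF sequentially_bot, symmetric])
    qed
  qed
  also have "\<dots> \<le> liminf (\<lambda>k. \<integral>\<^sup>+ x. ennreal ((cmod (F k x - g x))\<^sup>2) \<partial>halfline)"
    by (rule nn_integral_liminf) measurable
  also have "\<dots> = liminf (\<lambda>k. ennreal ((norm (abs_L2 (F k) - abs_L2 g))\<^sup>2))"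
    by (simp add: nn_integral_norm_abs_L2 square_integrable_diff F g abs_L2_diff)
  also have "\<dots> \<le> liminf (\<lambda>k::nat. ennreal (e\<^sup>2))"
    by (rule Liminf_mono) (use le in \<open>auto elim!: eventually_mono intro!: ennreal_leI power_mono\<close>)
  finally have *: "(\<integral>\<^sup>+ x. ennreal ((cmod (f x - g x))\<^sup>2) \<partial>halfline) \<le> ennreal (e\<^sup>2)"
    by (simp add: Liminf_const)
  have sq: "square_integrable (\<lambda>x. f x - g x)"
    unfolding square_integrable_iff_nn_integral using * by (auto intro: le_less_trans)
  then have f': "square_integrable f"
    using square_integrable_add[OF sq g] by simp
  have "(norm (abs_L2 f - abs_L2 g))\<^sup>2 \<le> e\<^sup>2"
    using * e by (simp add: abs_L2_diff f' g nn_integral_norm_abs_L2 sq)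
  then show ?thesis
    using f' power2_le_imp_le[OF _ e] by blast
qed

text \<open>
  The weighted series of \<open>2^k \<bar>F (k+1) - F k\<bar>^2\<close> has a finite integral, hence is finite almost
  everywhere; its terms are then bounded and \<open>\<bar>F (k+1) - F k\<bar>\<close> decays geometrically.
\<close>

lemma AE_convergent_if_fast_L2_Cauchy:
  fixes F :: "nat \<Rightarrow> real \<Rightarrow> complex"
  assumes F: "\<And>k. square_integrable (F k)"
    and fast: "\<And>k. norm (abs_L2 (F (Suc k)) - abs_L2 (F k)) \<le> (1/2) ^ k"
  shows "AE x in halfline. convergent (\<lambda>k. F k x)"
proof -
  have [measurable]: "\<And>k. F k \<in> borel_measurable halfline"
    using assms by (auto simp: square_integrable_def)
  define d where "d k x = 2 ^ k * (cmod (F (Suc k) x - F k x))\<^sup>2" for k x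
  have d0: "0 \<le> d k x" for k x by (simp add: d_def)
  have [measurable]: "d k \<in> borel_measurable halfline" for k
    unfolding d_def by measurable
  have "(\<integral>\<^sup>+ x. (\<Sum>k. ennreal (d k x)) \<partial>halfline) = (\<Sum>k. \<integral>\<^sup>+ x. ennreal (d k x) \<partial>halfline)"
    by (rule nn_integral_suminf) measurable
  also have "\<dots> \<le> (\<Sum>k. ennreal ((1/2) ^ k))"
  proof (rule suminf_le)
    fix k
    have "(\<integral>\<^sup>+ x. ennreal (d k x) \<partial>halfline)
        = ennreal (2 ^ k) * (\<integral>\<^sup>+ x. ennreal ((cmod (F (Suc k) x - F k x))\<^sup>2) \<partial>halfline)"
      unfolding d_def by (subst nn_integral_cmult[symmetric]) (auto simp: ennreal_mult)
    also have "\<dots> = ennreal (2 ^ k * (norm (abs_L2 (F (Suc k)) - abs_L2 (F k)))\<^sup>2)"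
      by (simp add: nn_integral_norm_abs_L2 square_integrable_diff F abs_L2_diff ennreal_mult)
    also have "\<dots> \<le> ennreal (2 ^ k * ((1/2) ^ k)\<^sup>2)"
      by (intro ennreal_leI mult_left_mono power_mono fast) auto
    also have "(2::real) ^ k * ((1/2) ^ k)\<^sup>2 = (1/2) ^ k"
      by (simp add: power2_eq_square power_divide)
    finally show "(\<integral>\<^sup>+ x. ennreal (d k x) \<partial>halfline) \<le> ennreal ((1/2) ^ k)" .
  qed auto
  also have "\<dots> = ennreal (\<Sum>k. (1/2) ^ k)"
    by (rule suminf_ennreal2) auto
  finally have "(\<integral>\<^sup>+ x. (\<Sum>k. ennreal (d k x)) \<partial>halfline) \<noteq> \<infinity>"
    by (auto simp: top_unique)
  then have "AE x in halfline. (\<Sum>k. ennreal (d k x)) \<noteq> \<infinity>"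
    by (intro nn_integral_PInf_AE) auto
  then show ?thesis
  proof eventually_elim
    fix x assume "(\<Sum>k. ennreal (d k x)) \<noteq> \<infinity>"
    then have sm: "summable (\<lambda>k. d k x)"
      using d0 by (intro summable_suminf_not_top) auto
    define S where "S = (\<Sum>k. d k x)"
    have dS: "d k x \<le> S" for k
      unfolding S_def using sum_le_suminf[OF sm, of "{k}"] d0 by auto
    have S0: "0 \<le> S" using dS d0 order_trans by blast
    have bound: "norm (F (Suc k) x - F k x) \<le> sqrt S * (sqrt (1/2)) ^ k" for k
    proof (rule power2_le_imp_le)
      have eq: "(sqrt S * (sqrt (1/2)) ^ k)\<^sup>2 = S * (1/2) ^ k"
        using S0 by (simp add: power_mult_distrib) (simp add: power_even_eq[symmetric] power_mult)
      then show "(norm (F (Suc k) x - F k x))\<^sup>2 \<le> (sqrt S * (sqrt (1/2)) ^ k)\<^sup>2"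
        unfolding eq using dS[of k] by (simp add: d_def field_simps)
    qed (use S0 in auto)
    have "summable (\<lambda>k. F (Suc k) x - F k x)"
      by (rule summable_comparison_test'[OF _ bound]) (auto intro!: summable_mult summable_geometric)
    then have "convergent (\<lambda>n. \<Sum>k<n. F (Suc k) x - F k x)"
      by (simp add: summable_iff_convergent)
    then have "convergent (\<lambda>n. F n x - F 0 x)"
      unfolding sum_lessThan_telescope[of "\<lambda>k. F k x"] .
    then show "convergent (\<lambda>k. F k x)"
      by (simp add: convergent_diff_const_right_iff)
  qed
qed

text \<open>
The Riesz--Fischer theorem.
\<close>

instance L2 :: complete_space
proof
  fix X :: "nat \<Rightarrow> L2" assume X: "Cauchy X"
  have "\<exists>F. \<forall>n. square_integrable (F n) \<and> X n = abs_L2 (F n)"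
    by (rule choice) (metis L2_cases)
  then obtain F where F: "\<And>n. square_integrable (F n)" and XF: "\<And>n. X n = abs_L2 (F n)"
    by blast
  have [measurable]: "\<And>k. F k \<in> borel_measurable halfline"
    using F by (auto simp: square_integrable_def)
  have "\<exists>N. \<forall>k. \<forall>m\<ge>N k. \<forall>n\<ge>N k. dist (X m) (X n) < (1/2) ^ k"
    by (rule choice) (use X in \<open>auto simp: Cauchy_def\<close>)
  then obtain N where N: "\<And>k m n. m \<ge> N k \<Longrightarrow> n \<ge> N k \<Longrightarrow> dist (X m) (X n) < (1/2) ^ k"
    by blast
  \<comment> \<open>The indices \<open>r k\<close> need not be strictly increasing; it suffices that \<open>N j \<le> r k\<close> for \<open>j \<le> k\<close>.\<close>
  define r where "r k = (\<Sum>i\<le>k. N i)" for k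
  have r: "N j \<le> r k" if "j \<le> k" for j k
    unfolding r_def using that by (intro member_le_sum) auto
  have "AE x in halfline. convergent (\<lambda>k. F (r k) x)"
  proof (rule AE_convergent_if_fast_L2_Cauchy)
    show "norm (abs_L2 (F (r (Suc k))) - abs_L2 (F (r k))) \<le> (1/2) ^ k" for k
      using N[where k=k, OF r[of k "Suc k"] r[of k k]] by (simp add: XF dist_norm)
  qed (rule F)
  then have lim: "AE x in halfline. (\<lambda>k. F (r k) x) \<longlonglongrightarrow> lim (\<lambda>k. F (r k) x)"
    by (simp add: convergent_LIMSEQ_iff)
  define f where "f x = lim (\<lambda>k. F (r k) x)" for x
  have f: "f \<in> borel_measurable halfline"
    unfolding f_def by (rule borel_measurable_lim_metric) measurable
  have *: "square_integrable f \<and> norm (abs_L2 f - X m) \<le> (1/2) ^ j" if "N j \<le> m" for j m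
    unfolding XF
  proof (rule L2_limit_pointwise_AE[OF _ F f])
    show "AE x in halfline. (\<lambda>k. F (r k) x) \<longlonglongrightarrow> f x"
      using lim by (simp add: f_def)
    show "\<forall>\<^sub>F k in sequentially. norm (abs_L2 (F (r k)) - abs_L2 (F m)) \<le> (1 / 2) ^ j"
      using eventually_ge_at_top[of j]
      by eventually_elim (use N[OF r that] in \<open>auto simp: dist_norm XF intro!: less_imp_le\<close>)
  qed (rule F)
  have "X \<longlonglongrightarrow> abs_L2 f"
    unfolding LIMSEQ_def
  proof safe
    fix e :: real assume "0 < e"
    then obtain j where j: "(1/2) ^ j < e"
      using real_arch_pow_inv[of e "1/2"] by auto
    have "dist (X m) (abs_L2 f) < e" if "N j \<le> m" for m
      using *[OF that] j by (simp add: dist_norm norm_minus_commute)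
    then show "\<exists>no. \<forall>n\<ge>no. dist (X n) (abs_L2 f) < e" by blast
  qed
  then show "convergent X" by (auto simp: convergent_def)
qed

section \<open>Spectrum of nonnegative self-adjoint operators\<close>

lemma cinner_commute: "cinner f g = cnj (cinner g f)"
  by transfer (simp add: L2_eq_def flip: Bochner_Integration.integral_cnj add: mult.commute)

lemma cinner_add_left: "cinner (f + g) h = cinner f h + cinner g h"
  by transfer (simp add: L2_eq_def distrib_right square_integrable_mult_cnj)

lemma cinner_scaleC_left: "cinner (c *\<^sub>C f) g = c * cinner f g"
  by transfer (simp add: mult.assoc)

lemma cinner_scaleC_right: "cinner f (c *\<^sub>C g) = cnj c * cinner f g"
  by (subst (1 2) cinner_commute) (simp add: cinner_scaleC_left)

lemma scaleC_add_right: "c *\<^sub>C (f + g) = c *\<^sub>C f + c *\<^sub>C g"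
  by transfer (simp add: L2_eq_def distrib_left square_integrable_add square_integrable_scale)

lemma scaleC_add_left: "(c + d) *\<^sub>C f = c *\<^sub>C f + d *\<^sub>C f"
  by transfer (simp add: L2_eq_def distrib_right square_integrable_add square_integrable_scale)

lemma scaleC_scaleC: "c *\<^sub>C d *\<^sub>C f = (c * d) *\<^sub>C f"
  by transfer (simp add: L2_eq_def mult.assoc square_integrable_scale)

lemma scaleC_of_real: "complex_of_real r *\<^sub>C f = r *\<^sub>R f"
  by (simp add: scaleR_L2_def)

lemma cinner_self: "cinner f f = complex_of_real ((norm f)\<^sup>2)"
proof -
  have "Im (cinner f f) = 0"
    using arg_cong[OF cinner_commute[of f f], of Im] by simp
  then show ?thesis
    by (simp add: complex_eq_iff power2_norm_eq_inner inner_L2_def)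
qed

lemma norm_scaleC: "norm (c *\<^sub>C f) = cmod c * norm f"
proof (rule power2_eq_imp_eq)
  have "cinner (c *\<^sub>C f) (c *\<^sub>C f) = (c * cnj c) * cinner f f"
    by (simp add: cinner_scaleC_left cinner_scaleC_right)
  then have "complex_of_real ((norm (c *\<^sub>C f))\<^sup>2) = complex_of_real ((cmod c * norm f)\<^sup>2)"
    by (simp only: cinner_self complex_norm_square[symmetric] power_mult_distrib of_real_mult)
  then show "(norm (c *\<^sub>C f))\<^sup>2 = (cmod c * norm f)\<^sup>2"
    by (simp only: of_real_eq_iff)
qed auto

lemma bounded_linear_scaleC: "bounded_linear (scaleC c)"
proof (rule bounded_linear_intro)
  show "c *\<^sub>C (r *\<^sub>R f) = r *\<^sub>R (c *\<^sub>C f)" for r f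
    by (simp add: scaleC_of_real[symmetric] scaleC_scaleC mult.commute)
  show "norm (c *\<^sub>C f) \<le> norm f * cmod c" for f
    by (simp add: norm_scaleC)
qed (rule scaleC_add_right)

lemmas scaleC_diff_right = linear_diff[OF bounded_linear.linear[OF bounded_linear_scaleC]]
lemmas scaleC_zero_right = linear_0[OF bounded_linear.linear[OF bounded_linear_scaleC]]

text \<open>
  The residual of the best approximation of \<open>y\<close> in \<open>S\<close>; a minimizing sequence is Cauchy by the
  parallelogram identity.
\<close>

lemma orthogonal_vector_exists:
  fixes S :: "'a::{real_inner,complete_space} set"
  assumes S: "subspace S" "closed S" and y: "y \<notin> S"
  obtains v where "v \<noteq> 0" "\<And>s. s \<in> S \<Longrightarrow> s \<bullet> v = 0"
proof -
  have ne: "S \<noteq> {}" using subspace_0[OF S(1)] by blast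
  define d where "d = infdist y S"
  have d0: "0 \<le> d" by (simp add: d_def infdist_nonneg)
  have d_le: "d \<le> norm (y - s)" if "s \<in> S" for s
    using infdist_le[OF that, of y] by (simp add: d_def dist_norm)
  have "\<exists>s. s \<in> S \<and> norm (y - s) < d + 1 / real (Suc n)" for n
  proof (rule ccontr)
    assume *: "\<nexists>s. s \<in> S \<and> norm (y - s) < d + 1 / real (Suc n)"
    have "d + 1 / real (Suc n) \<le> infdist y S"
      unfolding infdist_notempty[OF ne] using * ne
      by (intro cINF_greatest) (auto simp: dist_norm not_less)
    then show False by (simp add: d_def)
  qed
  then obtain s where s: "\<And>n. s n \<in> S" and sd: "\<And>n. norm (y - s n) < d + 1 / real (Suc n)"
    by metis
  have lim: "(\<lambda>n. norm (y - s n)) \<longlonglongrightarrow> d"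
  proof (rule tendsto_sandwich[of "\<lambda>_. d"])
    show "(\<lambda>n. d + 1 / real (Suc n)) \<longlonglongrightarrow> d"
      using tendsto_add[OF tendsto_const LIMSEQ_inverse_real_of_nat, of d]
      by (simp add: inverse_eq_divide)
    show "\<forall>\<^sub>F n in sequentially. norm (y - s n) \<le> d + 1 / real (Suc n)"
      by (intro always_eventually allI less_imp_le sd)
  qed (auto intro!: always_eventually d_le s)
  have par: "(norm (s m - s n))\<^sup>2 \<le> 2 * (norm (y - s m))\<^sup>2 + 2 * (norm (y - s n))\<^sup>2 - 4 * d\<^sup>2" for m n
  proof -
    have "d \<le> norm (y - (1/2) *\<^sub>R (s m + s n))"
      by (intro d_le subspace_scale subspace_add S s)
    then have "d\<^sup>2 \<le> (norm (y - (1/2) *\<^sub>R (s m + s n)))\<^sup>2"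
      using d0 by (rule power_mono)
    moreover have "(norm (s m - s n))\<^sup>2 + 4 * (norm (y - (1/2) *\<^sub>R (s m + s n)))\<^sup>2
        = 2 * (norm (y - s m))\<^sup>2 + 2 * (norm (y - s n))\<^sup>2"
      unfolding power2_norm_eq_inner by (simp add: algebra_simps inner_commute)
    ultimately show ?thesis by linarith
  qed
  have "Cauchy s"
  proof (rule metric_CauchyI)
    fix e :: real assume e: "0 < e"
    have "(\<lambda>n. 4 * (norm (y - s n))\<^sup>2 - 4 * d\<^sup>2) \<longlonglongrightarrow> 4 * d\<^sup>2 - 4 * d\<^sup>2"
      by (intro tendsto_intros lim)
    then have "\<forall>\<^sub>F n in sequentially. 4 * (norm (y - s n))\<^sup>2 - 4 * d\<^sup>2 < e\<^sup>2"
      using e by (intro order_tendstoD(2)) auto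
    then obtain N where N: "\<And>n. n \<ge> N \<Longrightarrow> 4 * (norm (y - s n))\<^sup>2 - 4 * d\<^sup>2 < e\<^sup>2"
      by (auto simp: eventually_sequentially)
    have "dist (s m) (s n) < e" if "m \<ge> N" "n \<ge> N" for m n
    proof (rule power2_less_imp_less)
      show "(dist (s m) (s n))\<^sup>2 < e\<^sup>2"
        using par[of m n] N[OF that(1)] N[OF that(2)] by (simp add: dist_norm)
    qed (use e in auto)
    then show "\<exists>M. \<forall>m\<ge>M. \<forall>n\<ge>M. dist (s m) (s n) < e" by blast
  qed
  then obtain l where l: "s \<longlonglongrightarrow> l"
    using Cauchy_convergent_iff convergent_def by blast
  have lS: "l \<in> S"
    using closed_sequentially[OF S(2) s l] .
  have "(\<lambda>n. norm (y - s n)) \<longlonglongrightarrow> norm (y - l)"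
    by (intro tendsto_intros l)
  then have yl: "norm (y - l) = d"
    using lim LIMSEQ_unique by blast
  show ?thesis
  proof
    show "y - l \<noteq> 0" using y lS by auto
    fix t assume t: "t \<in> S"
    show "t \<bullet> (y - l) = 0"
    proof (cases "t = 0")
      case False
      define r where "r = (t \<bullet> (y - l)) / (t \<bullet> t)"
      have tt: "t \<bullet> t > 0" using False by simp
      have "d \<le> norm (y - (l + r *\<^sub>R t))"
        by (intro d_le subspace_scale subspace_add S lS t)
      then have "(norm (y - l))\<^sup>2 \<le> (norm (y - (l + r *\<^sub>R t)))\<^sup>2"
        unfolding yl using d0 by (rule power_mono)
      also have "\<dots> = (norm (y - l))\<^sup>2 - 2 * r * (t \<bullet> (y - l)) + r * (r * (t \<bullet> t))"
        unfolding power2_norm_eq_inner by (simp add: algebra_simps inner_commute)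
      also have "r * (t \<bullet> t) = t \<bullet> (y - l)" using tt by (simp add: r_def)
      finally have "r * (t \<bullet> (y - l)) \<le> 0" by simp
      then have "(t \<bullet> (y - l))\<^sup>2 \<le> 0"
        using tt by (simp add: r_def power2_eq_square divide_le_0_iff)
      then show ?thesis by simp
    qed simp
  qed
qed

lemma linear_operator_diff:
  assumes "linear_operator T" "(u, w) \<in> T" "(u', w') \<in> T"
  shows "(u - u', w - w') \<in> T"
proof -
  have "(complex_of_real (-1) *\<^sub>C u', complex_of_real (-1) *\<^sub>C w') \<in> T"
    using assms unfolding linear_operator_def by blast
  then have "(- u', - w') \<in> T"
    unfolding scaleC_of_real by simp
  then have "(u + - u', w + - w') \<in> T"
    using assms unfolding linear_operator_def by blast
  then show ?thesis by simp
qed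

lemma linear_operator_add:
  assumes "linear_operator T" "(u, w) \<in> T" "(u', w') \<in> T"
  shows "(u + u', w + w') \<in> T"
  using assms unfolding linear_operator_def by blast

lemma linear_operator_scaleC:
  assumes "linear_operator T" "(u, w) \<in> T"
  shows "(c *\<^sub>C u, c *\<^sub>C w) \<in> T"
  using assms unfolding linear_operator_def by blast

lemma linear_operator_scaleR:
  assumes "linear_operator T" "(u, w) \<in> T"
  shows "(r *\<^sub>R u, r *\<^sub>R w) \<in> T"
  using linear_operator_scaleC[OF assms, of "complex_of_real r"] by (simp add: scaleC_of_real)

text \<open>
  The range of \<open>T - z\<close> is closed because \<open>T\<close> is closed and \<open>T - z\<close> is bounded below, and a vector
  orthogonal to it lies in the kernel of \<open>T - cnj z\<close>, which is trivial.
\<close>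

lemma self_adjoint_bounded_below_resolvent:
  assumes sa: "self_adjoint T" and cl: "closed T" and d: "d > 0"
    and below: "\<And>u w. (u, w) \<in> T \<Longrightarrow> d * norm u \<le> norm (w - z *\<^sub>C u)"
    and below': "\<And>u w. (u, w) \<in> T \<Longrightarrow> d * norm u \<le> norm (w - cnj z *\<^sub>C u)"
  shows "z \<in> resolvent_set T"
proof -
  have lin: "linear_operator T" and adj: "adjoint_graph T = T"
    using sa by (auto simp: self_adjoint_def)
  note T_add = linear_operator_add[OF lin] and T_diff = linear_operator_diff[OF lin]
    and T_scaleR = linear_operator_scaleR[OF lin] and T_scaleC = linear_operator_scaleC[OF lin]
  have zR: "z *\<^sub>C (r *\<^sub>R f) = r *\<^sub>R (z *\<^sub>C f)" for r f
    using linear_scale[OF bounded_linear.linear[OF bounded_linear_scaleC]] .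
  define S where "S = {w - z *\<^sub>C u |u w. (u, w) \<in> T}"
  have SI: "w - z *\<^sub>C u \<in> S" if "(u, w) \<in> T" for u w
    using that by (auto simp: S_def)
  have SD: "\<exists>u. (u, f + z *\<^sub>C u) \<in> T" if f: "f \<in> S" for f
  proof -
    obtain u w where "(u, w) \<in> T" "f = w - z *\<^sub>C u"
      using f by (auto simp: S_def)
    then show ?thesis by (intro exI[of _ u]) simp
  qed
  have "subspace S"
    unfolding subspace_def
  proof (intro conjI ballI allI)
    have "(0, 0) \<in> T" using lin by (simp add: linear_operator_def)
    then show "0 \<in> S" using SI[of 0 0] by (simp add: scaleC_zero_right)
  next
    fix x y assume "x \<in> S" "y \<in> S"
    then obtain u w u' w' where "(u, w) \<in> T" "(u', w') \<in> T" "x = w - z *\<^sub>C u" "y = w' - z *\<^sub>C u'"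
      by (auto simp: S_def)
    moreover from this have sum: "x + y = (w + w') - z *\<^sub>C (u + u')"
      by (simp add: scaleC_add_right)
    ultimately show "x + y \<in> S"
      unfolding sum by (intro SI T_add)
  next
    fix r x assume "x \<in> S"
    then obtain u w where "(u, w) \<in> T" "x = w - z *\<^sub>C u"
      by (auto simp: S_def)
    moreover from this have scale: "r *\<^sub>R x = r *\<^sub>R w - z *\<^sub>C (r *\<^sub>R u)"
      by (simp add: zR scaleR_diff_right)
    ultimately show "r *\<^sub>R x \<in> S"
      unfolding scale by (intro SI T_scaleR)
  qed
  moreover have "closed S"
    unfolding closed_sequential_limits
  proof (intro allI impI, elim conjE)
    fix x l assume xS: "\<forall>n. x n \<in> S" and xl: "x \<longlonglongrightarrow> l"
    then have "\<forall>n. \<exists>u. (u, x n + z *\<^sub>C u) \<in> T"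
      using SD by blast
    then obtain u where u: "\<And>n. (u n, x n + z *\<^sub>C u n) \<in> T" by metis
    have ineq: "d * norm (u m - u n) \<le> norm (x m - x n)" for m n
      using below[OF T_diff[OF u[of m] u[of n]]] by (simp add: scaleC_diff_right algebra_simps)
    have "Cauchy u"
    proof (rule metric_CauchyI)
      fix e :: real assume "0 < e"
      then have "0 < d * e" using d by simp
      with LIMSEQ_imp_Cauchy[OF xl] obtain M where
        M: "\<And>m n. m \<ge> M \<Longrightarrow> n \<ge> M \<Longrightarrow> dist (x m) (x n) < d * e"
        by (meson metric_CauchyD)
      have "dist (u m) (u n) < e" if "m \<ge> M" "n \<ge> M" for m n
      proof -
        have "d * norm (u m - u n) < d * e"
          using ineq[of m n] M[OF that] by (simp add: dist_norm)
        then show ?thesis using d by (simp add: dist_norm)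
      qed
      then show "\<exists>M. \<forall>m\<ge>M. \<forall>n\<ge>M. dist (u m) (u n) < e" by blast
    qed
    then obtain v where v: "u \<longlonglongrightarrow> v"
      using Cauchy_convergent_iff convergent_def by blast
    have lim: "(\<lambda>n. (u n, x n + z *\<^sub>C u n)) \<longlonglongrightarrow> (v, l + z *\<^sub>C v)"
      by (intro tendsto_intros v xl bounded_linear.tendsto[OF bounded_linear_scaleC])
    have "(v, l + z *\<^sub>C v) \<in> T"
      by (rule closed_sequentially[OF cl _ lim]) (rule u)
    from SI[OF this] show "l \<in> S" by simp
  qed
  ultimately have sub: "subspace S" "closed S" by auto
  have "S = UNIV"
  proof (rule ccontr)
    assume "S \<noteq> UNIV"
    then obtain y where "y \<notin> S" by auto
    from orthogonal_vector_exists[OF sub this] obtain v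
      where v: "v \<noteq> 0" "\<And>s. s \<in> S \<Longrightarrow> s \<bullet> v = 0" by metis
    \<comment> \<open>The inner product of the real vector space is only the real part; \<open>S\<close> is stable under \<open>\<i>\<close>.\<close>
    have zero: "cinner (w - z *\<^sub>C u) v = 0" if "(u, w) \<in> T" for u w
    proof -
      have 1: "Re (cinner (w - z *\<^sub>C u) v) = 0"
        using v(2)[OF SI[OF that]] by (simp add: inner_L2_def)
      have "\<i> *\<^sub>C (w - z *\<^sub>C u) = \<i> *\<^sub>C w - z *\<^sub>C (\<i> *\<^sub>C u)"
        by (simp add: scaleC_diff_right scaleC_scaleC mult.commute)
      then have "\<i> *\<^sub>C (w - z *\<^sub>C u) \<in> S"
        using SI[OF T_scaleC[OF that, of \<i>]] by simp
      then have "Re (cinner (\<i> *\<^sub>C (w - z *\<^sub>C u)) v) = 0"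
        using v(2) by (simp add: inner_L2_def)
      with 1 show ?thesis by (simp add: cinner_scaleC_left complex_eq_iff)
    qed
    have "cinner w v = cinner u (cnj z *\<^sub>C v)" if "(u, w) \<in> T" for u w
      using zero[OF that] cinner_add_left[of "w - z *\<^sub>C u" "z *\<^sub>C u" v]
      by (simp add: cinner_scaleC_left cinner_scaleC_right)
    then have "(v, cnj z *\<^sub>C v) \<in> adjoint_graph T"
      by (auto simp: adjoint_graph_def)
    then have "d * norm v \<le> 0"
      using below'[of v "cnj z *\<^sub>C v"] adj by simp
    then show False using d v(1) by (simp add: mult_le_0_iff)
  qed
  then have "\<forall>f. \<exists>u. (u, f + z *\<^sub>C u) \<in> T"
    using SD by blast
  then obtain R where R: "\<And>f. (R f, f + z *\<^sub>C R f) \<in> T" by metis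
  have uniq: "u = R f" if "(u, w) \<in> T" "f = w - z *\<^sub>C u" for u w f
  proof -
    have zero: "w - (f + z *\<^sub>C R f) - z *\<^sub>C (u - R f) = 0"
      using that(2) by (simp add: scaleC_diff_right)
    have "d * norm (u - R f) \<le> 0"
      using below[OF T_diff[OF that(1) R[of f]]] unfolding zero by simp
    then show ?thesis using d by (simp add: mult_le_0_iff)
  qed
  have "bounded_linear R"
  proof (rule bounded_linear_intro)
    show "R (f + g) = R f + R g" for f g
      by (rule uniq[OF T_add[OF R[of f] R[of g]], symmetric]) (simp add: scaleC_add_right algebra_simps)
    show "R (r *\<^sub>R f) = r *\<^sub>R R f" for r f
      by (rule uniq[OF T_scaleR[OF R[of f]], symmetric]) (simp add: zR algebra_simps)
    show "norm (R f) \<le> norm f * (1 / d)" for f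
      using below[OF R[of f]] d by (simp add: field_simps)
  qed
  moreover have "{(w - z *\<^sub>C u, u) |u w. (u, w) \<in> T} = {(f, R f) |f. True}"
  proof (intro equalityI subsetI; elim CollectE exE conjE)
    fix x u w assume "x = (w - z *\<^sub>C u, u)" "(u, w) \<in> T"
    with uniq[OF this(2) refl] show "x \<in> {(f, R f) |f. True}" by simp
  next
    fix x f assume x: "x = (f, R f)"
    have "\<exists>u w. (f, R f) = (w - z *\<^sub>C u, u) \<and> (u, w) \<in> T"
      using R[of f] by (intro exI[of _ "R f"] exI[of _ "f + z *\<^sub>C R f"]) auto
    then show "x \<in> {(w - z *\<^sub>C u, u) |u w. (u, w) \<in> T}"
      unfolding x by simp
  qed
  ultimately show ?thesis unfolding resolvent_set_def by blast
qed

text \<open>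
  The constant is \<open>\<bar>Im z\<bar>\<close> for nonreal \<open>z\<close> and \<open>\<bar>z\<bar>\<close> for negative \<open>z\<close>. It does not depend on the
  operator, of which only symmetry and nonnegativity at \<open>u\<close> are needed.
\<close>

lemma nonneg_operator_bounded_below:
  assumes "z \<notin> complex_of_real ` {0..}"
  obtains d where "d > 0"
    "\<And>u w. cinner w u = cinner u w \<Longrightarrow> 0 \<le> w \<bullet> u \<Longrightarrow> d * norm u \<le> norm (w - z *\<^sub>C u)"
proof -
  define x y where "x = Re z" and "y = Im z"
  have z: "z = complex_of_real x + complex_of_real y * \<i>"
    by (simp add: complex_eq_iff x_def y_def)
  have expand: "(norm (w - z *\<^sub>C u))\<^sup>2 = (norm (w - x *\<^sub>R u))\<^sup>2 + y\<^sup>2 * (norm u)\<^sup>2"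
    if sym: "cinner w u = cinner u w" for u w
  proof -
    have "Im (cinner w u) = 0"
      using arg_cong[OF cinner_commute[of w u], of Im] sym by simp
    moreover have "u \<bullet> (\<i> *\<^sub>C u) = 0"
      by (simp add: inner_L2_def cinner_scaleC_right cinner_self)
    ultimately have orth: "(w - x *\<^sub>R u) \<bullet> (\<i> *\<^sub>C u) = 0"
      by (simp add: inner_diff_left) (simp add: inner_L2_def cinner_scaleC_right)
    have split: "w - z *\<^sub>C u = (w - x *\<^sub>R u) - y *\<^sub>R (\<i> *\<^sub>C u)"
      by (simp add: z scaleC_add_left scaleC_scaleC[symmetric] scaleC_of_real)
    have "(norm (a - y *\<^sub>R b))\<^sup>2 = (norm a)\<^sup>2 + y\<^sup>2 * (norm b)\<^sup>2" if "a \<bullet> b = 0" for a b :: L2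
      using that unfolding power2_norm_eq_inner
      by (simp add: inner_diff_left inner_diff_right inner_commute[of b a] power2_eq_square)
    from this[OF orth] show ?thesis
      unfolding split by (simp add: norm_scaleC)
  qed
  show ?thesis
  proof (cases "y = 0")
    case False
    show ?thesis
    proof
      show "\<bar>y\<bar> > 0" using False by simp
      show "\<bar>y\<bar> * norm u \<le> norm (w - z *\<^sub>C u)" if "cinner w u = cinner u w" for u w
        by (rule power2_le_imp_le) (simp_all add: expand[OF that] power_mult_distrib)
    qed
  next
    case True
    then have "z = complex_of_real x" using z by simp
    then have x: "x < 0" using assms by force
    show ?thesis
    proof
      show "- x > 0" using x by simp
      show "- x * norm u \<le> norm (w - z *\<^sub>C u)" if "cinner w u = cinner u w" "0 \<le> w \<bullet> u" for u w
      proof (rule power2_le_imp_le)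
        have "(norm (w - x *\<^sub>R u))\<^sup>2 = (norm w)\<^sup>2 + 2 * (- x) * (w \<bullet> u) + x\<^sup>2 * (norm u)\<^sup>2"
          unfolding power2_norm_eq_inner by (simp add: algebra_simps inner_commute power2_eq_square)
        moreover have "0 \<le> 2 * (- x) * (w \<bullet> u)"
          using x that(2) by (intro mult_nonneg_nonneg) auto
        moreover have "0 \<le> (norm w)\<^sup>2" by simp
        ultimately have "x\<^sup>2 * (norm u)\<^sup>2 \<le> (norm (w - x *\<^sub>R u))\<^sup>2" by linarith
        then show "(- x * norm u)\<^sup>2 \<le> (norm (w - z *\<^sub>C u))\<^sup>2"
          by (simp add: expand[OF that(1)] power_mult_distrib True)
      qed simp
    qed
  qed
qed

lemma self_adjoint_nonneg_spectrum:
  assumes sa: "self_adjoint T" and cl: "closed T"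
    and nonneg: "\<And>u w. (u, w) \<in> T \<Longrightarrow> 0 \<le> w \<bullet> u"
  shows "spectrum T \<subseteq> complex_of_real ` {0..}"
proof
  fix z assume z: "z \<in> spectrum T"
  show "z \<in> complex_of_real ` {0..}"
  proof (rule ccontr)
    assume nz: "z \<notin> complex_of_real ` {0..}"
    then have nz': "cnj z \<notin> complex_of_real ` {0..}"
      by (metis complex_cnj_cnj complex_cnj_complex_of_real imageE imageI)
    have sym: "cinner w u = cinner u w" if "(u, w) \<in> T" for u w
    proof -
      have "(u, w) \<in> adjoint_graph T" using sa that by (simp add: self_adjoint_def)
      then show ?thesis using that unfolding adjoint_graph_def by blast
    qed
    obtain d where d: "d > 0"
      "\<And>u w. cinner w u = cinner u w \<Longrightarrow> 0 \<le> w \<bullet> u \<Longrightarrow> d * norm u \<le> norm (w - z *\<^sub>C u)"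
      using nonneg_operator_bounded_below[OF nz] by metis
    obtain d' where d': "d' > 0"
      "\<And>u w. cinner w u = cinner u w \<Longrightarrow> 0 \<le> w \<bullet> u \<Longrightarrow> d' * norm u \<le> norm (w - cnj z *\<^sub>C u)"
      using nonneg_operator_bounded_below[OF nz'] by metis
    have "z \<in> resolvent_set T"
    proof (rule self_adjoint_bounded_below_resolvent[OF sa cl])
      show "min d d' > 0" using d d' by simp
      fix u w assume uw: "(u, w) \<in> T"
      show "min d d' * norm u \<le> norm (w - z *\<^sub>C u)"
        by (rule order_trans[OF mult_right_mono d(2)[OF sym[OF uw] nonneg[OF uw]]]) auto
      show "min d d' * norm u \<le> norm (w - cnj z *\<^sub>C u)"
        by (rule order_trans[OF mult_right_mono d'(2)[OF sym[OF uw] nonneg[OF uw]]]) auto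
    qed
    with z show False by (simp add: spectrum_def)
  qed
qed

section \<open>The calibration profile and Young's inequality\<close>

text \<open>
  The function \<open>g\<close> of the calibration. For \<open>p = 1\<close> the exponent \<open>2 / (p - 1)\<close> is infinite and the
  square root equals 1 on \<open>(-1, 1)\<close>, which is why this case is separate. Only values in \<open>[-1, 1]\<close>
  matter; for \<open>p > 1\<close> the maximum with 0 extends the profile by 0.
\<close>

definition profile :: "real \<Rightarrow> real \<Rightarrow> real" where
  "profile p t = (if p = 1 then \<bar>t\<bar>
     else \<bar>t\<bar> * sqrt (max 0 (1 - \<bar>t\<bar> powr (2 / (p - 1)))))"

text \<open>
The integral of the profile over \<open>[0, 1]\<close>, see \<open>profile_has_integral\<close>.
\<close>

definition profile_const :: "real \<Rightarrow> real" where
  "profile_const p = Gamma p * Gamma (3/2) / (2 * Gamma (p + 1/2))"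

text \<open>
The constant of Young's inequality in \<open>young_profile\<close>, sharp for each \<open>k\<close>.
\<close>

definition young_const :: "real \<Rightarrow> real \<Rightarrow> real" where
  "young_const p k = k powr (1 - p) * (if p = 1 then 1 else (p - 1) powr (p - 1)) / p powr p"

lemma profile_minus: "profile p (- t) = profile p t"
  by (simp add: profile_def)

lemma continuous_on_profile:
  assumes "p \<ge> 1"
  shows "continuous_on S (profile p)"
proof (cases "p = 1")
  case True
  then show ?thesis by (auto simp: profile_def[abs_def] intro!: continuous_intros)
next
  case False
  then show ?thesis using assms
    by (auto simp: profile_def[abs_def] intro!: continuous_intros continuous_on_powr')
qed

lemma profile_has_integral:
  assumes p: "p \<ge> 1"
  shows "(profile p has_integral profile_const p) {0..1}"
proof (cases "p = 1")
  case True
  have "((\<lambda>t::real. t) has_integral (1\<^sup>2 / 2 - 0\<^sup>2 / 2)) {0..1}"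
    by (intro fundamental_theorem_of_calculus)
      (auto intro!: derivative_eq_intros simp flip: has_real_derivative_iff_has_vector_derivative)
  then have "((\<lambda>t::real. t) has_integral 1 / 2) {0..1}"
    by simp
  moreover have half: "profile_const p = 1 / 2"
    using Gamma_eq_zero_iff[of "3/2 :: real"] True by (auto simp: profile_const_def)
  moreover have "profile p t = t" if "t \<in> {0..1}" for t
    using True that by (simp add: profile_def)
  ultimately show ?thesis
    unfolding half using has_integral_cong[of "{0..1}" "profile p" "\<lambda>t. t"] by simp
next
  case False
  with p have p1: "p > 1" by simp
  let ?e = "2 / (p - 1)"
  define \<phi> \<phi>' f where "\<phi> s = s powr ?e" and "\<phi>' s = ?e * s powr (?e - 1)"
    and "f y = y powr (p - 1 - 1) * (1 - y) powr (3/2 - 1)" for s y :: real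
  let ?S = "{0<..<1::real}"
  have img: "\<phi> ` ?S = ?S"
  proof (intro equalityI subsetI)
    fix y assume "y \<in> \<phi> ` ?S"
    then obtain s where s: "0 < s" "s < 1" "y = s powr ?e" by (auto simp: \<phi>_def)
    have "s powr ?e < 1 powr ?e" using s p1 by (intro powr_less_mono2) auto
    then show "y \<in> ?S" using s by simp
  next
    fix y assume y: "y \<in> ?S"
    have "y powr (1 / ?e) < 1 powr (1 / ?e)" using y p1 by (intro powr_less_mono2) auto
    moreover have e: "1 / ?e * ?e = 1" using p1 by simp
    have "\<phi> (y powr (1 / ?e)) = y"
      unfolding \<phi>_def powr_powr e using y by simp
    ultimately show "y \<in> \<phi> ` ?S"
      using y by (intro image_eqI[where x = "y powr (1 / ?e)"]) auto
  qed
  \<comment> \<open>The substitution \<open>y = s powr (2 / (p - 1))\<close> turns the integral into a Beta integral.\<close>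
  have Beta: "(f has_integral Beta (p - 1) (3/2)) ?S"
    using has_integral_Beta_real[of "p - 1" "3/2"] p1
    unfolding f_def[abs_def] has_integral_Icc_iff_Ioo by simp
  have "f absolutely_integrable_on \<phi> ` ?S \<and> integral (\<phi> ` ?S) f = Beta (p - 1) (3/2)"
    unfolding img using Beta
    by (auto simp: f_def intro!: nonnegative_absolutely_integrable_1)
  then have "(\<lambda>s. \<bar>\<phi>' s\<bar> * f (\<phi> s)) absolutely_integrable_on ?S \<and>
      integral ?S (\<lambda>s. \<bar>\<phi>' s\<bar> * f (\<phi> s)) = Beta (p - 1) (3/2)"
  proof (rule has_absolute_integral_change_of_variables_1'[THEN iffD2, rotated 3])
    show "?S \<in> sets lebesgue" by simp
    show "(\<phi> has_real_derivative \<phi>' x) (at x within ?S)" if "x \<in> ?S" for x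
      unfolding \<phi>_def \<phi>'_def using that by (auto intro!: derivative_eq_intros)
    show "inj_on \<phi> ?S"
    proof (rule inj_onI)
      fix x y assume "x \<in> ?S" "y \<in> ?S" "\<phi> x = \<phi> y"
      have e: "?e * (1 / ?e) = 1" using p1 by simp
      have "(x powr ?e) powr (1 / ?e) = (y powr ?e) powr (1 / ?e)"
        using \<open>\<phi> x = \<phi> y\<close> by (simp only: \<phi>_def)
      then show "x = y"
        unfolding powr_powr e using \<open>x \<in> ?S\<close> \<open>y \<in> ?S\<close> by simp
    qed
  qed
  then have *: "((\<lambda>s. \<bar>\<phi>' s\<bar> * f (\<phi> s)) has_integral Beta (p - 1) (3/2)) ?S"
    by (auto simp: has_integral_iff absolutely_integrable_on_def)
  have "((\<lambda>s. (p - 1) / 2 * (\<bar>\<phi>' s\<bar> * f (\<phi> s))) has_integral (p - 1) / 2 * Beta (p - 1) (3/2)) ?S"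
    by (rule has_integral_mult_right[OF *])
  moreover have eq: "(p - 1) / 2 * (\<bar>\<phi>' s\<bar> * f (\<phi> s)) = profile p s" if s: "s \<in> ?S" for s
  proof -
    have "s powr ?e < 1 powr ?e" using s p1 by (intro powr_less_mono2) auto
    then have le1: "s powr ?e < 1" by simp
    have expo: "d - 1 + d * (p - 1 - 1) = 1" if "d * (p - 1) = 2" for d
      using that by (simp add: algebra_simps)
    have "s powr (?e - 1) * (s powr ?e) powr (p - 1 - 1) = s powr (?e - 1 + ?e * (p - 1 - 1))"
      using s by (simp add: powr_powr powr_add)
    also have "?e - 1 + ?e * (p - 1 - 1) = 1" by (rule expo) (use p1 in \<open>simp add: field_simps\<close>)
    finally have "s powr (?e - 1) * (s powr ?e) powr (p - 1 - 1) = s" using s by simp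
    moreover have "(1 - s powr ?e) powr (3/2 - 1) = sqrt (1 - s powr ?e)"
      using le1 by (simp add: powr_half_sqrt)
    moreover have "(p - 1) / 2 * \<bar>\<phi>' s\<bar> = s powr (?e - 1)"
      using p1 s by (simp add: \<phi>'_def abs_mult)
    ultimately have "(p - 1) / 2 * (\<bar>\<phi>' s\<bar> * f (\<phi> s)) = s * sqrt (1 - s powr ?e)"
      unfolding mult.assoc[symmetric] by (simp add: f_def \<phi>_def mult.assoc[symmetric])
    then show ?thesis
      using s le1 p1 by (simp add: profile_def)
  qed
  moreover have "(p - 1) / 2 * Beta (p - 1) (3/2) = profile_const p"
  proof -
    have "Gamma p = (p - 1) * Gamma (p - 1)"
      using Gamma_plus1[of "p - 1"] p1 by (simp add: nonpos_Ints_def)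
    then show ?thesis by (simp add: Beta_def profile_const_def add.commute mult.assoc)
  qed
  ultimately have "((\<lambda>s. (p - 1) / 2 * (\<bar>\<phi>' s\<bar> * f (\<phi> s))) has_integral profile_const p) ?S"
    by metis
  then have "(profile p has_integral profile_const p) ?S"
    by (rule has_integral_eq[rotated]) (rule eq)
  then show ?thesis by (simp add: has_integral_Icc_iff_Ioo)
qed

text \<open>
  The derivative is two-sided also at \<open>\<plusminus> 1\<close>, where the calibration reaches the maximum of \<open>\<bar>t\<bar>\<close>.
\<close>

lemma profile_primitive:
  assumes p: "p \<ge> 1"
  obtains G where "\<And>t. t \<in> {-1..1} \<Longrightarrow> (G has_real_derivative profile p t) (at t)"
    "G 0 = 0" "G 1 = profile_const p" "G (-1) = - profile_const p"
proof
  define H where "H x = integral {-2..x} (profile p)" for x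
  have cont: "continuous_on S (profile p)" for S by (rule continuous_on_profile[OF p])
  have int: "profile p integrable_on {x..y}" for x y
    by (rule integrable_continuous_real[OF cont])
  show "((\<lambda>x. H x - H 0) has_real_derivative profile p t) (at t)" if "t \<in> {-1..1}" for t
  proof -
    have "(H has_real_derivative profile p t) (at t within {-2..2})"
      unfolding H_def using that by (intro integral_has_real_derivative cont) auto
    moreover have "at t within {-2..2} = at t"
      using that by (intro at_within_interior) auto
    ultimately show ?thesis by (auto intro!: derivative_eq_intros)
  qed
  show "H 0 - H 0 = 0" by simp
  have "H 0 + integral {0..1} (profile p) = H 1"
    unfolding H_def by (rule Henstock_Kurzweil_Integration.integral_combine) (auto intro: int)
  then show "H 1 - H 0 = profile_const p"
    using integral_unique[OF profile_has_integral[OF p]] by simp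
  have "((\<lambda>t. profile p (- t)) has_integral profile_const p) {- 1.. - 0}"
    unfolding has_integral_reflect_real by (rule profile_has_integral[OF p])
  then have "integral {-1..0} (profile p) = profile_const p"
    by (simp add: profile_minus integral_unique)
  moreover have "H (-1) + integral {-1..0} (profile p) = H 0"
    unfolding H_def by (rule Henstock_Kurzweil_Integration.integral_combine) (auto intro: int)
  ultimately show "H (-1) - H 0 = - profile_const p" by simp
qed

text \<open>
  For \<open>p > 1\<close> the difference \<open>t^2 - g(t)^2\<close> equals \<open>(t^2) powr q\<close> with the conjugate exponent \<open>q\<close>, so
  this is Young's inequality for the product of \<open>W\<close> and \<open>t^2\<close>.
\<close>

lemma young_profile:
  assumes p: "p \<ge> 1" and k: "k > 0" and W: "W \<ge> 0" and t: "\<bar>t\<bar> \<le> 1"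
  shows "W * t\<^sup>2 \<le> k * (t\<^sup>2 - (profile p t)\<^sup>2) + young_const p k * W powr p"
proof (cases "p = 1")
  case True
  have "W * t\<^sup>2 \<le> W * 1"
    using W t by (intro mult_left_mono) (simp_all add: abs_square_le_1)
  then show ?thesis
    using True k W by (simp add: profile_def young_const_def)
next
  case False
  with p have p1: "p > 1" by simp
  show ?thesis
  proof (cases "t = 0")
    case True
    then show ?thesis using k by (simp add: profile_def young_const_def)
  next
    case t0: False
    define q where "q = p / (p - 1)"
    have q1: "q > 1" and pq: "1 / p + 1 / q = 1" using p1 by (auto simp: q_def field_simps)
    \<comment> \<open>This scaling gives the term in \<open>t\<close> the coefficient \<open>k\<close>.\<close>
    define c where "c = (k * q) powr (1 / q)"
    have kq: "k * q > 0" using k q1 by simp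
    then have c: "c > 0" unfolding c_def powr_gt_zero by (rule less_imp_neq[symmetric])
    have "(W / c) * (c * t\<^sup>2) \<le> (W / c) powr p / p + (c * t\<^sup>2) powr q / q"
      using W c by (intro Youngs_inequality p1 q1 pq) auto
    moreover have "(W / c) * (c * t\<^sup>2) = W * t\<^sup>2" using c by simp
    moreover have "(c * t\<^sup>2) powr q / q = k * (t\<^sup>2 - (profile p t)\<^sup>2)"
    proof -
      have "c powr q = k * q" using kq q1 by (simp add: c_def powr_powr)
      moreover have "(t\<^sup>2) powr q = t\<^sup>2 - (profile p t)\<^sup>2"
      proof -
        have "\<bar>t\<bar> powr (2 / (p - 1)) \<le> 1 powr (2 / (p - 1))"
          using t p1 by (intro powr_mono2) auto
        then have "(profile p t)\<^sup>2 = t\<^sup>2 * (1 - \<bar>t\<bar> powr (2 / (p - 1)))"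
          using p1 by (simp add: profile_def power_mult_distrib)
        moreover have "(t\<^sup>2) powr q = t\<^sup>2 * \<bar>t\<bar> powr (2 / (p - 1))"
        proof -
          have "(t\<^sup>2) powr q = (\<bar>t\<bar> powr 2) powr q" using t0 by (simp add: powr_numeral)
          also have "\<dots> = \<bar>t\<bar> powr (2 * q)" by (rule powr_powr)
          also have "2 * q = 2 + 2 / (p - 1)" using p1 by (simp add: q_def field_simps)
          also have "\<bar>t\<bar> powr \<dots> = t\<^sup>2 * \<bar>t\<bar> powr (2 / (p - 1))"
            using t0 by (simp add: powr_add powr_numeral)
          finally show ?thesis .
        qed
        ultimately show ?thesis by (simp add: algebra_simps)
      qed
      ultimately show ?thesis using c q1 by (simp add: powr_mult)
    qed
    moreover have "(W / c) powr p / p = young_const p k * W powr p"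
    proof -
      have "c powr p = (k * q) powr (p - 1)"
        using p1 by (simp add: c_def powr_powr q_def)
      also have "\<dots> = k powr (p - 1) * p powr (p - 1) / (p - 1) powr (p - 1)"
        using k p1 by (simp add: q_def powr_mult powr_divide)
      finally have cp: "c powr p = k powr (p - 1) * p powr (p - 1) / (p - 1) powr (p - 1)" .
      have pp: "p powr p = p * p powr (p - 1)"
        using p1 powr_add[of p 1 "p - 1"] by simp
      have kk: "k powr (1 - p) = 1 / k powr (p - 1)"
        using powr_minus_divide[of k "p - 1"] by simp
      have "(W / c) powr p / p = W powr p / (c powr p * p)"
        using W c by (simp add: powr_divide)
      also have "\<dots> = young_const p k * W powr p"
        unfolding cp young_const_def pp kk using p1 k by (simp add: field_simps)
      finally show ?thesis .
    qed
    ultimately show ?thesis by simp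
  qed
qed

lemma Gamma_legendre_duplication_real:
  fixes x :: real
  assumes "x > 0"
  shows "Gamma x * Gamma (x + 1/2) = 2 powr (1 - 2 * x) * sqrt pi * Gamma (2 * x)"
proof -
  have "complex_of_real x \<notin> \<int>\<^sub>\<le>\<^sub>0" "complex_of_real x + 1/2 \<notin> \<int>\<^sub>\<le>\<^sub>0"
    using assms by (auto elim!: nonpos_Ints_cases simp: complex_eq_iff)
  from Gamma_legendre_duplication[OF this]
  have "complex_of_real (Gamma x * Gamma (x + 1/2))
      = complex_of_real (exp ((1 - 2 * x) * ln 2) * sqrt pi * Gamma (2 * x))"
    by (simp flip: Gamma_complex_of_real exp_of_real)
  then show ?thesis
    unfolding of_real_eq_iff by (simp add: powr_def mult.commute)
qed

text \<open>
  The coupling at which the lower bound degenerates, for \<open>k = \<alpha> + 1/4\<close>, is the bound in the theorem.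
\<close>

lemma coupling_threshold_eq:
  assumes p: "p \<ge> 1" and k: "k > 0"
  shows "4 * sqrt k * profile_const p / young_const p k
    = (4 * k) powr ((2 * p - 1) / 2) * p powr p * (Gamma p)\<^sup>2
        / ((if p = 1 then 1 else (p - 1) powr (p - 1)) * Gamma (2 * p))"
proof -
  have p0: "p > 0" using p by simp
  define D where "D = (if p = 1 then 1 else (p - 1) powr (p - 1))"
  have D: "D > 0" using p by (auto simp: D_def)
  have pos: "Gamma p > 0" "Gamma (p + 1/2) > 0" "Gamma (2 * p) > 0"
    using p by (auto intro!: Gamma_real_pos)
  have "(1/2 :: real) \<notin> \<int>\<^sub>\<le>\<^sub>0"
    using nonpos_Ints_nonpos[of "1/2 :: real"] by auto
  from Gamma_plus1[OF this] have "Gamma (3/2 :: real) = 1/2 * Gamma (1/2)"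
    by simp
  then have G32: "Gamma (3/2 :: real) = sqrt pi / 2"
    by (simp add: Gamma_one_half_real)
  have "4 * profile_const p * Gamma (2 * p) * (Gamma p * Gamma (p + 1/2))
      = Gamma (2 * p) * sqrt pi * (Gamma p)\<^sup>2"
    using pos by (simp add: profile_const_def G32 power2_eq_square)
  then have eq: "4 * profile_const p * Gamma (2 * p) * 2 powr (1 - 2 * p) = (Gamma p)\<^sup>2"
    unfolding Gamma_legendre_duplication_real[OF p0] using pos by (simp add: mult_ac)
  have 4: "4 * profile_const p = 2 powr (2 * p - 1) * (Gamma p)\<^sup>2 / Gamma (2 * p)"
  proof -
    have "2 powr (1 - 2 * p) * 2 powr (2 * p - 1) = (1::real)"
      by (simp flip: powr_add)
    then have "4 * profile_const p * Gamma (2 * p)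
        = 4 * profile_const p * Gamma (2 * p) * (2 powr (1 - 2 * p) * 2 powr (2 * p - 1))"
      by simp
    also have "\<dots> = 2 powr (2 * p - 1) * (Gamma p)\<^sup>2"
      unfolding eq[symmetric] by (simp only: mult_ac)
    finally show ?thesis using pos by (simp add: eq_divide_eq)
  qed
  have "(4 * k) powr ((2 * p - 1) / 2) = 4 powr ((2 * p - 1) / 2) * k powr ((2 * p - 1) / 2)"
    using k by (simp add: powr_mult)
  also have "4 powr ((2 * p - 1) / 2) = 2 powr (2 * p - 1)"
    using powr_powr[of 2 2 "(2 * p - 1) / 2"] by simp
  also have "k powr ((2 * p - 1) / 2) = sqrt k * k powr (p - 1)"
    using k powr_add[of k "1/2" "p - 1"] by (simp add: powr_half_sqrt diff_divide_distrib)
  finally have "(4 * k) powr ((2 * p - 1) / 2) = 2 powr (2 * p - 1) * (sqrt k * k powr (p - 1))" .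
  moreover have kk: "k powr (1 - p) = 1 / k powr (p - 1)"
    using powr_minus_divide[of k "p - 1"] by simp
  moreover have "4 * sqrt k * profile_const p = sqrt k * (2 powr (2 * p - 1) * (Gamma p)\<^sup>2 / Gamma (2 * p))"
    unfolding 4[symmetric] by simp
  ultimately show ?thesis
    using pos k p D unfolding young_const_def D_def[symmetric] by (simp add: mult_ac)
qed

section \<open>Lower bound for the energy of a real function\<close>

text \<open>
  The calibrating function \<open>- f f' + f^2 / (2 x) + 2 s \<kappa> M^2 G(t)\<close> with \<open>t = f / (sqrt x * M)\<close>. The
  first two terms account for the integration by parts and for the substitution \<open>f = sqrt x * w\<close>;
  \<open>s = \<plusminus> 1\<close> selects the branch.
\<close>

lemma calibration_deriv:
  fixes f f' f'' G :: "real \<Rightarrow> real" and x M s \<kappa> g :: real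
  assumes x: "x > 0" and M: "M > 0"
    and f: "(f has_real_derivative f' x) (at x)"
    and f': "(f' has_real_derivative f'' x) (at x)"
    and G: "(G has_real_derivative g) (at (f x / (sqrt x * M)))"
  shows "((\<lambda>x. - f x * f' x + (f x)\<^sup>2 / (2 * x) + 2 * s * \<kappa> * M\<^sup>2 * G (f x / (sqrt x * M)))
    has_real_derivative
      (- (f' x)\<^sup>2 - f x * f'' x + f x * f' x / x - (f x)\<^sup>2 / (2 * x\<^sup>2)
       + 2 * s * \<kappa> * M * g * (f' x / sqrt x - f x / (2 * x * sqrt x)))) (at x)"
proof -
  define r where "r = sqrt x"
  have r: "r > 0" and xr: "x = r\<^sup>2" using x by (simp_all add: r_def)
  have "((\<lambda>x. f x / (sqrt x * M)) has_real_derivative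
      (f' x / sqrt x - f x / (2 * x * sqrt x)) / M) (at x)"
    using x M r
    by (auto intro!: derivative_eq_intros f simp: r_def[symmetric])
       (simp add: xr power2_eq_square field_simps)
  from DERIV_chain2[OF G this]
  have *: "((\<lambda>x. G (f x / (sqrt x * M))) has_real_derivative
      g * ((f' x / sqrt x - f x / (2 * x * sqrt x)) / M)) (at x)" .
  have "((\<lambda>x. - f x * f' x + (f x)\<^sup>2 / (2 * x)) has_real_derivative
      (- (f' x)\<^sup>2 - f x * f'' x + f x * f' x / x - (f x)\<^sup>2 / (2 * x\<^sup>2))) (at x)"
    using x by (auto intro!: derivative_eq_intros f f' simp: power2_eq_square field_simps)
  from DERIV_add[OF this DERIV_cmult[OF *, of "2 * s * \<kappa> * M\<^sup>2"]]
  show ?thesis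
    using M by (simp add: power2_eq_square mult.assoc)
qed

text \<open>
  Here \<open>f0\<close>, \<open>f1\<close>, \<open>f2\<close>, \<open>v\<close> stand for the values of \<open>f\<close>, its first two derivatives and the potential
  at \<open>x\<close>. The difference of the two sides is a sum of a square, the defect in Young's inequality and
  the contribution of the positive part of the potential.
\<close>

lemma calibration_pointwise:
  fixes f0 f1 f2 v x k p M s :: real
  assumes p: "p \<ge> 1" and k: "k > 0" and x: "x > 0" and M: "M > 0"
    and bound: "\<bar>f0 / (sqrt x * M)\<bar> \<le> 1" and s: "\<bar>s\<bar> = 1"
  shows "(- f1\<^sup>2 - f0 * f2 + f0 * f1 / x - f0\<^sup>2 / (2 * x\<^sup>2)
       + 2 * s * sqrt k * M * profile p (f0 / (sqrt x * M)) * (f1 / sqrt x - f0 / (2 * x * sqrt x)))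
     - young_const p k * M\<^sup>2 * (x powr (2 * p - 1) * \<bar>max 0 (- v)\<bar> powr p)
    \<le> - f2 * f0 + (k - 1/4) / x\<^sup>2 * f0\<^sup>2 + v * f0\<^sup>2"
proof -
  define r where "r = sqrt x"
  have r: "r > 0" and xr: "x = r\<^sup>2" using x by (simp_all add: r_def)
  define t where "t = f0 / (r * M)"
  have f0: "f0 = r * M * t" using r M by (simp add: t_def)
  define g where "g = profile p t"
  define \<kappa> where "\<kappa> = sqrt k"
  have k\<kappa>: "k = \<kappa>\<^sup>2" using k by (simp add: \<kappa>_def)
  define n where "n = \<bar>max 0 (- v)\<bar>"
  have n: "n \<ge> 0" "- n \<le> v" by (auto simp: n_def)
  \<comment> \<open>\<open>A\<close> is the derivative of \<open>w = f / sqrt x\<close>.\<close>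
  define A where "A = f1 / r - f0 / (2 * x * r)"
  have "x\<^sup>2 * n * t\<^sup>2 \<le> k * (t\<^sup>2 - g\<^sup>2) + young_const p k * (x\<^sup>2 * n) powr p"
    unfolding g_def using n bound by (intro young_profile p k) (auto simp: t_def r_def)
  then have "M\<^sup>2 / x * (x\<^sup>2 * n * t\<^sup>2)
      \<le> M\<^sup>2 / x * (k * (t\<^sup>2 - g\<^sup>2) + young_const p k * (x\<^sup>2 * n) powr p)"
    using x by (intro mult_left_mono) auto
  moreover have "M\<^sup>2 / x * (x\<^sup>2 * n * t\<^sup>2) = n * f0\<^sup>2"
    using r by (simp add: f0 xr power2_eq_square field_simps)
  moreover have "(x\<^sup>2 * n) powr p / x = x powr (2 * p - 1) * n powr p"
  proof -
    have "(x\<^sup>2) powr p = x powr (2 * p)"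
      using x powr_powr[of x 2 p] by (simp add: powr_numeral)
    then show ?thesis
      using x n by (simp add: powr_mult powr_diff)
  qed
  ultimately have young: "n * f0\<^sup>2 \<le> M\<^sup>2 / x * (k * (t\<^sup>2 - g\<^sup>2))
      + young_const p k * M\<^sup>2 * (x powr (2 * p - 1) * n powr p)"
    by (simp add: distrib_left mult_ac) (metis mult.assoc mult.commute times_divide_eq_right)
  have sq: "0 \<le> (r * A - s * \<kappa> * M * g / r)\<^sup>2" by simp
  have "s\<^sup>2 = 1" using s by (metis one_power2 power2_abs)
  then have "(r * A - s * \<kappa> * M * g / r)\<^sup>2 = x * A\<^sup>2 - 2 * s * \<kappa> * M * g * A + k * M\<^sup>2 * g\<^sup>2 / x"
    using r by (simp add: power2_diff power_mult_distrib power_divide xr k\<kappa>)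
  with sq have square: "2 * s * \<kappa> * M * g * A - k * M\<^sup>2 * g\<^sup>2 / x \<le> x * A\<^sup>2" by simp
  have A2: "x * A\<^sup>2 = f1\<^sup>2 - f0 * f1 / x + f0\<^sup>2 / (4 * x\<^sup>2)"
    using r by (simp add: A_def xr power2_eq_square field_simps)
  have kt: "M\<^sup>2 / x * (k * (t\<^sup>2 - g\<^sup>2)) = k / x\<^sup>2 * f0\<^sup>2 - k * M\<^sup>2 * g\<^sup>2 / x"
    using r by (simp add: f0 xr power2_eq_square field_simps)
  have vn: "- (n * f0\<^sup>2) \<le> v * f0\<^sup>2"
    using mult_right_mono[OF n(2), of "f0\<^sup>2"] by simp
  have "(- f1\<^sup>2 - f0 * f2 + f0 * f1 / x - f0\<^sup>2 / (2 * x\<^sup>2) + 2 * s * \<kappa> * M * g * A)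
     - young_const p k * M\<^sup>2 * (x powr (2 * p - 1) * n powr p)
    \<le> - f2 * f0 + (k - 1/4) / x\<^sup>2 * f0\<^sup>2 + v * f0\<^sup>2"
  proof -
    have "(k - 1/4) / x\<^sup>2 * f0\<^sup>2 = k / x\<^sup>2 * f0\<^sup>2 - f0\<^sup>2 / (4 * x\<^sup>2)"
      "f0\<^sup>2 / (2 * x\<^sup>2) = 2 * (f0\<^sup>2 / (4 * x\<^sup>2))"
      by (simp_all add: diff_divide_distrib left_diff_distrib)
    moreover have "f0 * f2 = f2 * f0" by simp
    ultimately show ?thesis using young square A2 kt vn by linarith
  qed
  then show ?thesis
    unfolding A_def g_def t_def r_def n_def \<kappa>_def .
qed

text \<open>
  The density \<open>D\<close> is the derivative of the calibrating function, with opposite signs on the two sides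
  of the maximum \<open>M\<close> of \<open>\<bar>f\<bar> / sqrt x\<close>. Stating the bound pointwise, with \<open>D\<close> integrable, avoids
  assuming that the right-hand side is integrable.
\<close>

lemma real_form_lower_bound:
  fixes f f' f'' V :: "real \<Rightarrow> real"
  assumes p: "p \<ge> 1" and k: "k > 0" and ab: "0 < a" "a < b"
    and f: "\<And>x. x \<in> {a..b} \<Longrightarrow> (f has_real_derivative f' x) (at x)"
    and f': "\<And>x. x \<in> {a..b} \<Longrightarrow> (f' has_real_derivative f'' x) (at x)"
    and fa: "f a = 0" and fb: "f b = 0"
  obtains D M where "0 \<le> M" "\<And>x. x \<in> {a..b} \<Longrightarrow> (f x)\<^sup>2 \<le> M\<^sup>2 * x"
    "(D has_integral 4 * sqrt k * profile_const p * M\<^sup>2) {a..b}"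
    "\<And>x. x \<in> {a..b} \<Longrightarrow>
      D x - young_const p k * M\<^sup>2 * (x powr (2 * p - 1) * \<bar>max 0 (- V x)\<bar> powr p)
      \<le> - f'' x * f x + (k - 1/4) / x\<^sup>2 * (f x)\<^sup>2 + V x * (f x)\<^sup>2"
proof -
  have cont: "continuous_on {a..b} f"
    using f by (intro continuous_at_imp_continuous_on ballI DERIV_isCont)
  have "continuous_on {a..b} (\<lambda>x. \<bar>f x\<bar> / sqrt x)"
    using ab by (intro continuous_intros cont) auto
  then obtain c where c: "c \<in> {a..b}" and
      max: "\<And>x. x \<in> {a..b} \<Longrightarrow> \<bar>f x\<bar> / sqrt x \<le> \<bar>f c\<bar> / sqrt c"
    using continuous_attains_sup[of "{a..b}" "\<lambda>x. \<bar>f x\<bar> / sqrt x"] ab by auto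
  define M where "M = \<bar>f c\<bar> / sqrt c"
  have pos: "x > 0" if "x \<in> {a..b}" for x using that ab by auto
  have M0: "0 \<le> M" using pos[OF c] by (simp add: M_def)
  have fM: "\<bar>f x\<bar> \<le> M * sqrt x" if "x \<in> {a..b}" for x
    using max[OF that] pos[OF that] by (simp add: M_def[symmetric] pos_divide_le_eq)
  have fM2: "(f x)\<^sup>2 \<le> M\<^sup>2 * x" if "x \<in> {a..b}" for x
    using power_mono[OF fM[OF that], of 2] pos[OF that] by (simp add: power_mult_distrib)
  show ?thesis
  proof (cases "M = 0")
    case True
    show ?thesis
    proof (rule that[of M "\<lambda>_. 0"])
      show "((\<lambda>_. 0) has_integral 4 * sqrt k * profile_const p * M\<^sup>2) {a..b}"
        using True by simp
      fix x assume "x \<in> {a..b}"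
      then have "f x = 0" using fM True by fastforce
      then show "0 - young_const p k * M\<^sup>2 * (x powr (2 * p - 1) * \<bar>max 0 (- V x)\<bar> powr p)
        \<le> - f'' x * f x + (k - 1/4) / x\<^sup>2 * (f x)\<^sup>2 + V x * (f x)\<^sup>2"
        using True by simp
    qed (use M0 fM2 in auto)
  next
    case False
    with M0 have M: "M > 0" by simp
    obtain G where G: "\<And>t. t \<in> {-1..1} \<Longrightarrow> (G has_real_derivative profile p t) (at t)"
      "G 0 = 0" "G 1 = profile_const p" "G (-1) = - profile_const p"
      using profile_primitive[OF p] by metis
    define w where "w x = f x / (sqrt x * M)" for x
    have w1: "\<bar>w x\<bar> \<le> 1" if "x \<in> {a..b}" for x
      using fM[OF that] pos[OF that] M by (simp add: w_def abs_mult pos_divide_le_eq mult.commute)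
    define F where "F s x = - f x * f' x + (f x)\<^sup>2 / (2 * x) + 2 * s * sqrt k * M\<^sup>2 * G (w x)" for s x
    define F' where "F' s x = - (f' x)\<^sup>2 - f x * f'' x + f x * f' x / x - (f x)\<^sup>2 / (2 * x\<^sup>2)
       + 2 * s * sqrt k * M * profile p (w x) * (f' x / sqrt x - f x / (2 * x * sqrt x))" for s x
    have deriv: "(F s has_real_derivative F' s x) (at x)" if "x \<in> {a..b}" for s x
    proof -
      have wt: "f x / (sqrt x * M) \<in> {-1..1}"
        using w1[OF that] by (simp add: w_def abs_le_iff minus_le_iff del: abs_divide)
      show ?thesis
        unfolding F_def[abs_def] F'_def w_def
        by (rule calibration_deriv[where f = f and f' = f' and f'' = f'' and G = G,
              OF pos[OF that] M f[OF that] f'[OF that] G(1)[OF wt]])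
    qed
    have F_int: "(F' s has_integral F s y - F s x) {x..y}" if "a \<le> x" "x \<le> y" "y \<le> b" for s x y
      using that deriv
      by (intro fundamental_theorem_of_calculus)
        (auto intro: has_field_derivative_at_within
          simp flip: has_real_derivative_iff_has_vector_derivative)
    define \<sigma> :: real where "\<sigma> = (if 0 \<le> f c then 1 else -1)"
    have wc: "w c = \<sigma>"
      using M pos[OF c] by (auto simp: w_def \<sigma>_def M_def divide_simps)
    have F0: "F s a = 0" "F s b = 0" for s
      by (simp_all add: F_def w_def fa fb G)
    have \<sigma>G: "\<sigma> * G \<sigma> = profile_const p" by (simp add: \<sigma>_def G)
    \<comment> \<open>The term in \<open>G\<close> runs from 0 to \<open>\<sigma> * G \<sigma>\<close> on \<open>[a, c]\<close> and back to 0 on \<open>[c, b]\<close>; the change of sign at \<open>c\<close> makes both contributions positive.\<close>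
    define D where "D x = (if x < c then F' \<sigma> x else F' (- \<sigma>) x)" for x
    have "(D has_integral F \<sigma> c) {a..c}"
      unfolding has_integral_Icc_iff_Ioo
      using F_int[of a c \<sigma>] c F0
      by (subst has_integral_cong[where g = "F' \<sigma>"]) (auto simp: D_def has_integral_Icc_iff_Ioo)
    moreover have "(D has_integral - F (- \<sigma>) c) {c..b}"
      using F_int[of c b "- \<sigma>"] c F0
      by (subst has_integral_cong[where g = "F' (- \<sigma>)"]) (auto simp: D_def)
    ultimately have "(D has_integral F \<sigma> c + - F (- \<sigma>) c) {a..b}"
      using c by (intro has_integral_combine[where c = c]) auto
    moreover have "F \<sigma> c + - F (- \<sigma>) c = 4 * sqrt k * profile_const p * M\<^sup>2"
      unfolding F_def wc \<sigma>G[symmetric] by simp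
    ultimately have D: "(D has_integral 4 * sqrt k * profile_const p * M\<^sup>2) {a..b}" by simp
    show ?thesis
    proof (rule that[OF M0 fM2 D])
      fix x assume x: "x \<in> {a..b}"
      have *: "F' s x - young_const p k * M\<^sup>2 * (x powr (2 * p - 1) * \<bar>max 0 (- V x)\<bar> powr p)
        \<le> - f'' x * f x + (k - 1/4) / x\<^sup>2 * (f x)\<^sup>2 + V x * (f x)\<^sup>2" if "\<bar>s\<bar> = 1" for s
        unfolding F'_def w_def
        using w1[OF x] that by (intro calibration_pointwise p k pos[OF x] M) (auto simp: w_def)
      show "D x - young_const p k * M\<^sup>2 * (x powr (2 * p - 1) * \<bar>max 0 (- V x)\<bar> powr p)
        \<le> - f'' x * f x + (k - 1/4) / x\<^sup>2 * (f x)\<^sup>2 + V x * (f x)\<^sup>2"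
        using *[of \<sigma>] *[of "- \<sigma>"] by (auto simp: D_def \<sigma>_def)
    qed
  qed
qed

section \<open>The quadratic form on test functions\<close>

lemma test_function_derivs:
  assumes u: "u \<in> test_functions" and l: "bounded_linear (l :: complex \<Rightarrow> real)"
  shows "((\<lambda>x. l (u x)) has_real_derivative l (vderiv u x)) (at x)"
    and "((\<lambda>x. l (vderiv u x)) has_real_derivative l (vderiv (vderiv u) x)) (at x)"
proof -
  have s: "(vderiv ^^ n) u differentiable at x" for n
    using u by (simp add: test_functions_def smooth_def)
  have "(u has_vector_derivative vderiv u x) (at x)"
    using s[of 0] by (simp add: vector_derivative_works)
  moreover have "(vderiv u has_vector_derivative vderiv (vderiv u) x) (at x)"
    using s[of 1] by (simp add: vector_derivative_works)
  ultimately show "((\<lambda>x. l (u x)) has_real_derivative l (vderiv u x)) (at x)"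
    and "((\<lambda>x. l (vderiv u x)) has_real_derivative l (vderiv (vderiv u) x)) (at x)"
    using bounded_linear.has_vector_derivative[OF l]
    by (simp_all add: has_real_derivative_iff_has_vector_derivative)
qed

lemma test_function_support:
  assumes "u \<in> test_functions"
  obtains a b where "0 < a" "a < b" "\<And>x. x \<notin> {a<..<b} \<Longrightarrow> u x = 0"
proof -
  obtain K where K: "compact K" "K \<subseteq> {0<..}" and supp: "\<And>x. x \<notin> K \<Longrightarrow> u x = 0"
    using assms by (auto simp: test_functions_def)
  show ?thesis
  proof (cases "K = {}")
    case True
    then show ?thesis using supp by (intro that[of 1 2]) auto
  next
    case False
    obtain m where m: "m \<in> K" "\<And>x. x \<in> K \<Longrightarrow> m \<le> x"
      using compact_attains_inf[OF K(1) False] by blast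
    obtain n where n: "n \<in> K" "\<And>x. x \<in> K \<Longrightarrow> x \<le> n"
      using compact_attains_sup[OF K(1) False] by blast
    have "0 < m" "m \<le> n" using m n K by auto
    show ?thesis
    proof (rule that[of "m / 2" "n + 1"])
      fix x assume "x \<notin> {m / 2<..<n + 1}"
      then have "x \<notin> K" using m(2) n(2) \<open>0 < m\<close> by fastforce
      then show "u x = 0" by (rule supp)
    qed (use \<open>0 < m\<close> \<open>m \<le> n\<close> in auto)
  qed
qed

text \<open>
  The strict pointwise control on the left, rather than mere nonnegativity of the form, is what
  excludes a zero mode.
\<close>

lemma schroedinger_form_lower_bound:
  fixes V :: "real \<Rightarrow> real"
  assumes p: "p \<ge> 1" and k: "\<alpha> + 1/4 > 0" and V: "V \<in> L2_loc" and u: "u \<in> test_functions"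
    and W: "integrable halfline (\<lambda>x. x powr (2 * p - 1) * \<bar>max 0 (- V x)\<bar> powr p)"
    and \<delta>: "\<delta> = 4 * sqrt (\<alpha> + 1/4) * profile_const p - young_const p (\<alpha> + 1/4)
        * (\<integral>x. x powr (2 * p - 1) * \<bar>max 0 (- V x)\<bar> powr p \<partial>halfline)" "\<delta> > 0"
    and x: "x > 0"
  shows "\<delta> * (cmod (u x))\<^sup>2 \<le> x * (abs_L2 (schroedinger_expr \<alpha> V u) \<bullet> abs_L2 u)"
proof -
  define k where "k = \<alpha> + 1/4"
  define C where "C = young_const p k"
  define W where "W x = x powr (2 * p - 1) * \<bar>max 0 (- V x)\<bar> powr p" for x
  define I where "I = (\<integral>x. W x \<partial>halfline)"
  have k0: "k > 0" and \<alpha>: "\<alpha> = k - 1/4" using k by (simp_all add: k_def)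
  have \<delta>_eq: "\<delta> = 4 * sqrt k * profile_const p - C * I"
    by (simp add: \<delta>(1) k_def C_def I_def W_def)
  have W0: "0 \<le> W x" for x by (simp add: W_def)
  have C0: "0 \<le> C" using k0 p by (auto simp: C_def young_const_def)
  obtain a b where ab: "0 < a" "a < b" and supp: "\<And>x. x \<notin> {a<..<b} \<Longrightarrow> u x = 0"
    using test_function_support[OF u] by metis
  note d = test_function_derivs[OF u]
  define P where "P l x = - l (vderiv (vderiv u) x) * l (u x) + (k - 1/4) / x\<^sup>2 * (l (u x))\<^sup>2
      + V x * (l (u x))\<^sup>2" for l :: "complex \<Rightarrow> real" and x
  have bound: "\<exists>D M. (\<forall>x\<in>{a..b}. (l (u x))\<^sup>2 \<le> M\<^sup>2 * x) \<and>
      (D has_integral 4 * sqrt k * profile_const p * M\<^sup>2) {a..b} \<and>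
      (\<forall>x\<in>{a..b}. D x - C * M\<^sup>2 * W x \<le> P l x)" if l: "bounded_linear l" for l :: "complex \<Rightarrow> real"
  proof -
    have l0: "l 0 = 0" using l by (simp add: bounded_linear.linear linear_0)
    show ?thesis
    proof (rule real_form_lower_bound[OF p k0 ab d(1)[OF l] d(2)[OF l], of V])
      show "l (u a) = 0" "l (u b) = 0" using supp by (simp_all add: l0)
    next
      fix D M
      assume "\<And>x. x \<in> {a..b} \<Longrightarrow> (l (u x))\<^sup>2 \<le> M\<^sup>2 * x"
        "(D has_integral 4 * sqrt k * profile_const p * M\<^sup>2) {a..b}"
        "\<And>x. x \<in> {a..b} \<Longrightarrow>
          D x - young_const p k * M\<^sup>2 * (x powr (2 * p - 1) * \<bar>max 0 (- V x)\<bar> powr p)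
          \<le> - l (vderiv (vderiv u) x) * l (u x) + (k - 1/4) / x\<^sup>2 * (l (u x))\<^sup>2 + V x * (l (u x))\<^sup>2"
      then show ?thesis
        by (intro exI[of _ D] exI[of _ M]) (simp add: P_def C_def W_def)
    qed
  qed
  obtain D\<^sub>r M\<^sub>r where r: "\<And>x. x \<in> {a..b} \<Longrightarrow> (Re (u x))\<^sup>2 \<le> M\<^sub>r\<^sup>2 * x"
      "(D\<^sub>r has_integral 4 * sqrt k * profile_const p * M\<^sub>r\<^sup>2) {a..b}"
      "\<And>x. x \<in> {a..b} \<Longrightarrow> D\<^sub>r x - C * M\<^sub>r\<^sup>2 * W x \<le> P Re x"
    using bound[OF bounded_linear_Re] by blast
  obtain D\<^sub>i M\<^sub>i where i: "\<And>x. x \<in> {a..b} \<Longrightarrow> (Im (u x))\<^sup>2 \<le> M\<^sub>i\<^sup>2 * x"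
      "(D\<^sub>i has_integral 4 * sqrt k * profile_const p * M\<^sub>i\<^sup>2) {a..b}"
      "\<And>x. x \<in> {a..b} \<Longrightarrow> D\<^sub>i x - C * M\<^sub>i\<^sup>2 * W x \<le> P Im x"
    using bound[OF bounded_linear_Im] by blast
  define N where "N = M\<^sub>r\<^sup>2 + M\<^sub>i\<^sup>2"
  have N0: "0 \<le> N" by (simp add: N_def)
  define Q where "Q x = Re (schroedinger_expr \<alpha> V u x * cnj (u x))" for x
  have Q: "Q x = P Re x + P Im x" for x
  proof -
    have "Re ((- d + complex_of_real c * z + complex_of_real v * z) * cnj z)
        = (- Re d * Re z + c * (Re z)\<^sup>2 + v * (Re z)\<^sup>2) + (- Im d * Im z + c * (Im z)\<^sup>2 + v * (Im z)\<^sup>2)"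
      for d z :: complex and c v :: real
      by (simp add: power2_eq_square algebra_simps)
    then show ?thesis
      unfolding Q_def P_def schroedinger_expr_def \<alpha> .
  qed
  have su: "square_integrable (schroedinger_expr \<alpha> V u)" "square_integrable u"
    using schroedinger_expr_square_integrable[OF u V] test_functions_square_integrable[OF u] by auto
  define q where "q = abs_L2 (schroedinger_expr \<alpha> V u) \<bullet> abs_L2 u"
  note int = square_integrable_mult_cnj[OF su]
  have "q = (\<integral>x. Q x \<partial>halfline)"
    unfolding q_def inner_L2_def cinner_abs_L2[OF su] Q_def by (rule integral_Re[OF int, symmetric])
  moreover have "integrable halfline Q"
    unfolding Q_def using int by (rule integrable_Re)
  ultimately have Q_int: "(Q has_integral q) {0<..}"
    using has_integral_integral_lebesgue_on[of "{0<..}" Q] by simp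
  have W_int: "(W has_integral I) {0<..}"
    unfolding I_def using W has_integral_integral_lebesgue_on[of "{0<..}" W] by (simp add: W_def[abs_def])
  define D where "D x = (if x \<in> {a..b} then D\<^sub>r x + D\<^sub>i x else 0)" for x
  have "((\<lambda>x. D\<^sub>r x + D\<^sub>i x) has_integral 4 * sqrt k * profile_const p * N) {a..b}"
    using has_integral_add[OF r(2) i(2)] by (simp add: N_def distrib_left)
  then have "(D has_integral 4 * sqrt k * profile_const p * N) {a..b}"
    by (subst has_integral_cong[where g = "\<lambda>x. D\<^sub>r x + D\<^sub>i x"]) (auto simp: D_def)
  then have D_int: "(D has_integral 4 * sqrt k * profile_const p * N) {0<..}"
    by (rule has_integral_on_superset) (use ab in \<open>auto simp: D_def\<close>)
  have "4 * sqrt k * profile_const p * N - C * N * I \<le> q"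
  proof (rule has_integral_le[OF has_integral_diff[OF D_int has_integral_mult_right[OF W_int]] Q_int])
    fix x :: real assume "x \<in> {0<..}"
    show "D x - C * N * W x \<le> Q x"
    proof (cases "x \<in> {a..b}")
      case True
      then show ?thesis
        using r(3)[OF True] i(3)[OF True] by (simp add: D_def Q N_def algebra_simps)
    next
      case False
      then have "u x = 0" by (intro supp) auto
      then show ?thesis
        using False C0 N0 W0[of x] by (auto simp: D_def Q_def)
    qed
  qed
  then have \<delta>N: "\<delta> * N \<le> q" by (simp add: \<delta>_eq algebra_simps)
  have "(cmod (u x))\<^sup>2 \<le> N * x"
  proof (cases "x \<in> {a..b}")
    case True
    then show ?thesis
      using r(1)[OF True] i(1)[OF True] by (simp add: cmod_power2 N_def distrib_right)
  next
    case False
    then have "u x = 0" by (intro supp) auto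
    then show ?thesis using N0 x by simp
  qed
  then have "\<delta> * (cmod (u x))\<^sup>2 \<le> \<delta> * (N * x)"
    using \<delta>(2) by (intro mult_left_mono) auto
  also have "\<dots> = x * (\<delta> * N)" by simp
  also have "\<dots> \<le> x * q" using \<delta>N x by (intro mult_left_mono) auto
  finally show ?thesis by (simp add: q_def)
qed

section \<open>Nonnegative spectrum and absence of zero modes\<close>

theorem theoremA1:
  fixes \<alpha> p :: real and V :: "real \<Rightarrow> real"
  assumes "\<alpha> > - 1 / 4"
    and "V \<in> L2_loc"
    and "self_adjoint (closure (schroedinger_min \<alpha> V))"
    and "p \<ge> 1"
    and "(\<integral>\<^sup>+ \<rho>. ennreal (\<rho> powr (2 * p - 1) * \<bar>max 0 (- V \<rho>)\<bar> powr p) \<partial>halfline)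
      < ennreal ((4 * \<alpha> + 1) powr ((2 * p - 1) / 2) * p powr p * (Gamma p)\<^sup>2
          / ((if p = 1 then 1 else (p - 1) powr (p - 1)) * Gamma (2 * p)))"
  shows "spectrum (closure (schroedinger_min \<alpha> V)) \<subseteq> complex_of_real ` {0..} \<and>
    \<not> eigenvalue (closure (schroedinger_min \<alpha> V)) 0"
proof -
  let ?A = "schroedinger_min \<alpha> V"
  define k where "k = \<alpha> + 1/4"
  have k: "k > 0" using assms(1) by (simp add: k_def)
  define W where "W x = x powr (2 * p - 1) * \<bar>max 0 (- V x)\<bar> powr p" for x
  define I where "I = (\<integral>x. W x \<partial>halfline)"
  define \<delta> where "\<delta> = 4 * sqrt k * profile_const p - young_const p k * I"
  have W0: "0 \<le> W x" for x by (simp add: W_def)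
  have [measurable]: "V \<in> borel_measurable halfline"
    using assms(2) by (simp add: L2_loc_def)
  have [measurable]: "(\<lambda>x. x) \<in> borel_measurable halfline"
    by (intro measurable_restrict_space1 measurable_completion) simp
  have W_meas: "W \<in> borel_measurable halfline"
    unfolding W_def by measurable
  have lt: "(\<integral>\<^sup>+ x. ennreal (W x) \<partial>halfline) < ennreal (4 * sqrt k * profile_const p / young_const p k)"
    unfolding coupling_threshold_eq[OF assms(4) k] using assms(5) by (simp add: W_def k_def distrib_left add.commute)
  then have W_int: "integrable halfline W"
    using W_meas W0 by (auto simp: integrable_iff_bounded intro: less_trans)
  have "ennreal I = (\<integral>\<^sup>+ x. ennreal (W x) \<partial>halfline)"
    unfolding I_def using W_int W0 by (simp add: nn_integral_eq_integral)
  with lt have "ennreal I < ennreal (4 * sqrt k * profile_const p / young_const p k)"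
    by simp
  moreover have "0 \<le> I"
    using W0 by (simp add: I_def)
  ultimately have "I < 4 * sqrt k * profile_const p / young_const p k"
    by (simp add: ennreal_less_iff)
  moreover have "young_const p k > 0"
    using k assms(4) by (auto simp: young_const_def)
  ultimately have \<delta>: "\<delta> > 0"
    by (simp add: \<delta>_def pos_less_divide_eq mult.commute)
  have form: "\<delta> * (cmod (\<phi> x))\<^sup>2 \<le> x * (abs_L2 (schroedinger_expr \<alpha> V \<phi>) \<bullet> abs_L2 \<phi>)"
    if "\<phi> \<in> test_functions" "x > 0" for \<phi> x
    by (rule schroedinger_form_lower_bound[OF assms(4) k[unfolded k_def] assms(2) that(1)
          W_int[unfolded W_def] _ \<delta> that(2)]) (simp add: \<delta>_def k_def I_def W_def)
  have nonneg: "0 \<le> w \<bullet> u" if "(u, w) \<in> closure ?A" for u w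
  proof -
    have "?A \<subseteq> {z. 0 \<le> snd z \<bullet> fst z}"
    proof
      fix z assume "z \<in> ?A"
      then obtain \<phi> where \<phi>: "\<phi> \<in> test_functions" "z = (abs_L2 \<phi>, abs_L2 (schroedinger_expr \<alpha> V \<phi>))"
        by (auto simp: schroedinger_min_def)
      have "0 \<le> \<delta> * (cmod (\<phi> 1))\<^sup>2" using \<delta> by simp
      with form[OF \<phi>(1), of 1] show "z \<in> {z. 0 \<le> snd z \<bullet> fst z}"
        by (simp add: \<phi>(2))
    qed
    moreover have "closed {z :: L2 \<times> L2. 0 \<le> snd z \<bullet> fst z}"
      by (intro closed_Collect_le continuous_intros)
    ultimately have "closure ?A \<subseteq> {z. 0 \<le> snd z \<bullet> fst z}"
      by (rule closure_minimal)
    with that show ?thesis by auto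
  qed
  have "\<not> eigenvalue (closure ?A) 0"
  proof
    assume "eigenvalue (closure ?A) 0"
    then obtain u where u: "u \<noteq> 0" "(u, 0) \<in> closure ?A"
      using scaleC_of_real[of 0] by (auto simp: eigenvalue_def)
    then obtain z where z: "\<And>n. z n \<in> ?A" "z \<longlonglongrightarrow> (u, 0)"
      unfolding closure_sequential by auto
    have "\<forall>n. \<exists>\<phi>. \<phi> \<in> test_functions \<and> z n = (abs_L2 \<phi>, abs_L2 (schroedinger_expr \<alpha> V \<phi>))"
      using z(1) by (auto simp: schroedinger_min_def)
    then obtain \<phi> where \<phi>: "\<And>n. \<phi> n \<in> test_functions"
      and z_eq: "\<And>n. z n = (abs_L2 (\<phi> n), abs_L2 (schroedinger_expr \<alpha> V (\<phi> n)))" by metis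
    have lim_u: "(\<lambda>n. abs_L2 (\<phi> n)) \<longlonglongrightarrow> u"
      using tendsto_fst[OF z(2)] by (simp add: z_eq)
    have lim_w: "(\<lambda>n. abs_L2 (schroedinger_expr \<alpha> V (\<phi> n))) \<longlonglongrightarrow> 0"
      using tendsto_snd[OF z(2)] by (simp add: z_eq)
    \<comment> \<open>The form bound turns \<open>\<langle>A \<phi>\<^sub>n, \<phi>\<^sub>n\<rangle> \<longlonglongrightarrow> 0\<close> into pointwise convergence.\<close>
    have pointwise: "(\<lambda>n. \<phi> n x) \<longlonglongrightarrow> 0" if x: "x > 0" for x
    proof -
      have "(\<lambda>n. x * (abs_L2 (schroedinger_expr \<alpha> V (\<phi> n)) \<bullet> abs_L2 (\<phi> n)) / \<delta>) \<longlonglongrightarrow> x * (0 \<bullet> u) / \<delta>"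
        using \<delta> by (intro tendsto_intros lim_u lim_w) auto
      then have lim0: "(\<lambda>n. x * (abs_L2 (schroedinger_expr \<alpha> V (\<phi> n)) \<bullet> abs_L2 (\<phi> n)) / \<delta>) \<longlonglongrightarrow> 0"
        by simp
      have "(\<lambda>n. (cmod (\<phi> n x))\<^sup>2) \<longlonglongrightarrow> 0"
      proof (rule tendsto_sandwich[OF _ _ tendsto_const lim0])
        show "\<forall>\<^sub>F n in sequentially. (cmod (\<phi> n x))\<^sup>2
            \<le> x * (abs_L2 (schroedinger_expr \<alpha> V (\<phi> n)) \<bullet> abs_L2 (\<phi> n)) / \<delta>"
          using form[OF \<phi> x] \<delta> by (simp add: pos_le_divide_eq mult.commute)
      qed simp
      then have "(\<lambda>n. sqrt ((cmod (\<phi> n x))\<^sup>2)) \<longlonglongrightarrow> sqrt 0"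
        by (intro tendsto_intros)
      then show ?thesis by (simp add: tendsto_norm_zero_iff)
    qed
    obtain f where f: "square_integrable f" "u = abs_L2 f" by (rule L2_cases)
    \<comment> \<open>By Fatou, the pointwise limit 0 and the limit \<open>u\<close> in the Hilbert space agree.\<close>
    have small: "norm (abs_L2 (\<lambda>x. 0) - abs_L2 f) \<le> e" if "e > 0" for e
    proof -
      have "\<forall>\<^sub>F n in sequentially. norm (abs_L2 (\<phi> n) - abs_L2 f) \<le> e"
        using tendstoD[OF lim_u that] by (auto simp: f(2) dist_norm elim!: eventually_mono)
      moreover have "AE x in halfline. (\<lambda>n. \<phi> n x) \<longlonglongrightarrow> 0"
        using pointwise by (intro AE_I2) (simp add: space_restrict_space)
      ultimately show ?thesis
        using L2_limit_pointwise_AE[OF test_functions_square_integrable[OF \<phi>] f(1)] by simp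
    qed
    have "norm (abs_L2 (\<lambda>x. 0) - abs_L2 f) \<le> 0"
      by (rule field_le_epsilon) (use small in simp)
    then have "u = 0" by (simp add: f(2) flip: zero_L2.abs_eq)
    with u(1) show False ..
  qed
  moreover have "spectrum (closure ?A) \<subseteq> complex_of_real ` {0..}"
    by (rule self_adjoint_nonneg_spectrum[OF assms(3) closed_closure nonneg])
  ultimately show ?thesis by blast
qed

end
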